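(* For every $\mathfrak{h}\ge1$ such that level $\mathfrak{h}$ of the hierarchy is defined, $\nu_{\mathfrak{h}}<\nu_{\mathfrak{h}-1}$. In particular, the construction terminates: there is a finite terminal level $\mathfrak{m}\ge1$ with $\nu_{\mathfrak{m}-1}>1$ and $\nu_{\mathfrak{m}}=1$.
   Context: Setting. Let $\Omega$ be a finite set with a connected undirected graph structure; write $\eta\sim\xi$ if $\{\eta,\xi\}$ is an edge. Let $\mathbb{H}:\Omega\to\mathbb{R}$. Paths and heights. A path $\omega:\eta\to\xi$ is a sequence $(\omega_n)_{n=0}^N$ with $\omega_0=\eta$, $\omega_N=\xi$ and $\omega_n\sim\omega_{n+1}$ ($N=0$ allowed). Its height is $\Phi_\omega:=\max_n\mathbb{H}(\omega_n)$. Set $\Phi(\eta,\xi):=\min_{\omega:\eta\to\xi}\Phi_\omega$. For nonempty sets, $\Phi(\mathcal{A},\mathcal{B}):=\min_{\eta\in\mathcal{A},\xi\in\mathcal{B}}\Phi(\eta,\xi)$, and $\Phi(\mathcal{A},\eta):=\Phi(\mathcal{A},\{\eta\})$. Ground states. $\mathcal{S}:=\operatorname{argmin}_\Omega\mathbb{H}$, $\overline{\Phi}:=\max_{s,s'\in\mathcal{S}}\Phi(s,s')$, and $\overline{\Omega}:=\{\eta:\Phi(\mathcal{S},\eta)\le\overline{\Phi}\}$. Sets. For $\mathcal{A}\subseteq\Omega$: $\mathcal{F}(\mathcal{A}):=\operatorname{argmin}_{\mathcal{A}}\mathbb{H}$; $\partial\mathcal{A}:=\{\eta\notin\mathcal{A}:\eta\sim\xi\text{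 for some }\xi\in\mathcal{A}\}$; $\partial^\star\mathcal{A}:=\mathcal{F}(\partial\mathcal{A})$. A set is connected if any two of its points are joined by a path inside it. Stable plateaux and cycles. A stable plateau is a nonempty connected set $\mathcal{P}$ with constant energy $\mathbb{H}(\mathcal{P})$ such that $\mathbb{H}>\mathbb{H}(\mathcal{P})$ on $\partial\mathcal{P}$. A cycle is a nonempty connected $\mathcal{C}$ with $\max_{\mathcal{C}}\mathbb{H}<\min_{\partial\mathcal{C}}\mathbb{H}$. Its depth is $\Gamma^{\mathcal{C}}:=\min_{\partial\mathcal{C}}\mathbb{H}-\min_{\mathcal{C}}\mathbb{H}$. General construction (C). Let $\mathscr{C}$ be a collection of pairwise disjoint cycles contained in $\overline{\Omega}$ with $|\mathscr{C}|\ge2$, and let $\Gamma^\star>0$. Put - $\mathscr{C}^\star:=\{\mathcal{C}\in\mathscr{C}:\Gamma^{\mathcal{C}}\ge\Gamma^\star\}$ and $\mathscr{C}^\sharp:=\{\mathcal{C}\in\mathscr{C}:\Gamma^{\mathcal{C}}<\Gamma^\star\}$; - $\mathscr{P}^{\mathscr{C}}:=\{\mathcal{F}(\mathcal{C}):\mathcal{C}\in\mathscr{C}\}$ and $\mathscr{P}^{\mathscr{C}^\star}:=\{\mathcal{F}(\mathcal{C}):\mathcal{C}\in\mathscr{C}^\star\}$; - $\Delta^{\mathscr{C}}:=\overline{\Omega}\setminus\bigcup_{\mathcal{C}\in\mathscr{C}}\mathcal{C}$. Let $\mathfrak{X}^{\mathscr{C}}$ be the continuous-time Markov chain on $\Omega^{\mathscr{C}}:=\Delta^{\mathscr{C}}\cup\mathscr{P}^{\mathscr{C}}$,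 in which each $\mathcal{F}(\mathcal{C})$ is treated as a single point. Its rates are: - $\mathfrak{R}^{\mathscr{C}}(\eta,\xi)=1$ for $\eta,\xi\in\Delta^{\mathscr{C}}$ with $\eta\sim\xi$ and $\mathbb{H}(\xi)\le\mathbb{H}(\eta)$; - $\mathfrak{R}^{\mathscr{C}}(\eta,\mathcal{F}(\mathcal{C}))=|\{\zeta\in\mathcal{C}:\eta\sim\zeta\}|$ for $\eta\in\Delta^{\mathscr{C}}\cap\partial\mathcal{C}$; - $\mathfrak{R}^{\mathscr{C}}(\mathcal{F}(\mathcal{C}),\eta)=|\mathcal{F}(\mathcal{C})|^{-1}|\{\zeta\in\mathcal{C}:\eta\sim\zeta\}|$ if $\Gamma^{\mathcal{C}}\le\Gamma^\star$ and $\eta\in\partial^\star\mathcal{C}$; - all other rates are $0$. The trace chain $\mathfrak{X}^{\mathscr{C}^\star}$ on $\mathscr{P}^{\mathscr{C}^\star}$ has rates, for distinct $\mathcal{C},\mathcal{C}'\in\mathscr{C}^\star$, $$\mathfrak{R}^{\mathscr{C}^\star}(\mathcal{F}(\mathcal{C}),\mathcal{F}(\mathcal{C}')):=\sum_{\eta\in\Delta^{\mathscr{C}}}\mathfrak{R}^{\mathscr{C}}(\mathcal{F}(\mathcal{C}),\eta)\,\mathbf{P}^{\mathscr{C}}_\eta[\mathcal{T}_{\mathcal{F}(\mathcal{C}')}=\mathcal{T}_{\mathscr{P}^{\mathscr{C}^\star}}].$$ Here $\mathbf{P}^{\mathscr{C}}_\eta$ is the law of $\mathfrak{X}^{\mathscr{C}}$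 started at $\eta$, and $\mathcal{T}_{\mathcal{A}}$ is the hitting time of $\mathcal{A}$. Hierarchy. Let $\mathscr{P}^1=\{\mathcal{P}_1^1,\dots,\mathcal{P}^1_{\nu_0}\}$ be the collection of all stable plateaux contained in $\overline{\Omega}$, and assume $\nu_0\ge2$. Suppose that at some level $\mathfrak{h}\ge1$ the sets $\mathcal{P}^{\mathfrak{h}}_1,\dots,\mathcal{P}^{\mathfrak{h}}_{\nu_{\mathfrak{h}-1}}$ are defined, with $\nu_{\mathfrak{h}-1}\ge2$. Then define: - $\mathbb{H}(\mathcal{P}^{\mathfrak{h}}_i):=\min_{\mathcal{P}^{\mathfrak{h}}_i}\mathbb{H}$; - $\mathscr{P}^{\star,\mathfrak{h}}:=\{\mathcal{P}^{\mathfrak{h}}_i:i\in[1,\nu_{\mathfrak{h}-1}]\}$; - $\breve{\mathcal{P}}^{\mathfrak{h}}_i:=\bigcup_{j\ne i}\mathcal{P}^{\mathfrak{h}}_j$; - $\Gamma^{\mathfrak{h}}_i:=\Phi(\mathcal{P}^{\mathfrak{h}}_i,\breve{\mathcal{P}}^{\mathfrak{h}}_i)-\mathbb{H}(\mathcal{P}^{\mathfrak{h}}_i)$ and $\Gamma^{\star,\mathfrak{h}}:=\min_i\Gamma_i^{\mathfrak{h}}$; - $\mathcal{V}^{\mathfrak{h}}_i:=\{\eta\in\Omega:\Phi(\mathcal{P}^{\mathfrak{h}}_i,\eta)-\mathbb{H}(\mathcal{P}^{\mathfrak{h}}_i)<\Gamma^{\mathfrak{h}}_i\}$. Set $\mathscr{C}^1:=\{\mathcal{V}^1_i:i\in[1,\nu_0]\}$.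 For $\mathfrak{h}\ge2$, set $$\mathscr{C}^{\mathfrak{h}}:=\{\mathcal{V}^{\mathfrak{h}}_i:i\in[1,\nu_{\mathfrak{h}-1}]\}\cup\{\mathcal{C}\in\mathscr{C}^{\star,\mathfrak{h}-1}_{\rm tr}\cup\mathscr{C}^{\sharp,\mathfrak{h}-1}:\mathcal{C}\cap\mathcal{V}^{\mathfrak{h}}_i=\emptyset\ \forall i\}.$$ Apply (C) to $(\mathscr{C}^{\mathfrak{h}},\Gamma^{\star,\mathfrak{h}})$. Write $\mathscr{C}^{\star,\mathfrak{h}}:=(\mathscr{C}^{\mathfrak{h}})^\star$ and $\mathscr{C}^{\sharp,\mathfrak{h}}:=(\mathscr{C}^{\mathfrak{h}})^\sharp$. Let $\mathfrak{X}^{\star,\mathfrak{h}}$ be the trace chain of (C) on $\mathscr{P}^{(\mathscr{C}^{\mathfrak{h}})^\star}$. Decompose $\mathscr{P}^{(\mathscr{C}^{\mathfrak{h}})^\star}$ into the closed communicating classes $\mathscr{P}^{\star,\mathfrak{h}}_1,\dots,\mathscr{P}^{\star,\mathfrak{h}}_{\nu_{\mathfrak{h}}}$ of $\mathfrak{X}^{\star,\mathfrak{h}}$ and the set $\mathscr{P}^{\star,\mathfrak{h}}_{\rm tr}$ of transient elements. Let $\mathscr{C}^{\star,\mathfrak{h}}_m:=\{\mathcal{C}\in\mathscr{C}^{\star,\mathfrak{h}}:\mathcal{F}(\mathcal{C})\in\mathscr{P}^{\star,\mathfrak{h}}_m\}$ for $m\in\{1,\dots,\nu_{\mathfrak{h}},{\rm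 tr}\}$. If $\nu_{\mathfrak{h}}\ge2$, define $\mathcal{P}^{\mathfrak{h}+1}_i:=\bigcup_{\mathcal{P}\in\mathscr{P}^{\star,\mathfrak{h}}_i}\mathcal{P}$ for $i\in[1,\nu_{\mathfrak{h}}]$ and continue to level $\mathfrak{h}+1$. The terminal level $\mathfrak{m}$ is the first $\mathfrak{h}$ with $\nu_{\mathfrak{h}}=1$. Finally, $\mathscr{P}^{\star,\mathfrak{h}}_{\rm rec}:=\mathscr{P}^{\star,\mathfrak{h}}_1\cup\dots\cup\mathscr{P}^{\star,\mathfrak{h}}_{\nu_{\mathfrak{h}}}$. Here $[a,b]$ denotes the set of integers from $a$ to $b$. *)

theory Defs
  imports Complex_Main
begin

text \<open>Energy landscape on a finite type 'a (the state space Omega = UNIV),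
  with adjacency relation E (undirected graph) and Hamiltonian H.\<close>

definition walk :: "('a \<Rightarrow> 'a \<Rightarrow> bool) \<Rightarrow> 'a list \<Rightarrow> 'a \<Rightarrow> 'a \<Rightarrow> bool" where
  "walk E xs x y \<longleftrightarrow> xs \<noteq> [] \<and> hd xs = x \<and> last xs = y \<and> successively E xs"

definition Phi :: "('a::finite \<Rightarrow> 'a \<Rightarrow> bool) \<Rightarrow> ('a \<Rightarrow> real) \<Rightarrow> 'a \<Rightarrow> 'a \<Rightarrow> real" where
  "Phi E H x y = Min {Max (H ` set xs) | xs. walk E xs x y}"

definition PhiS :: "('a::finite \<Rightarrow> 'a \<Rightarrow> bool) \<Rightarrow> ('a \<Rightarrow> real) \<Rightarrow> 'a set \<Rightarrow> 'a set \<Rightarrow> real" where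
  "PhiS E H A B = Min {Phi E H x y | x y. x \<in> A \<and> y \<in> B}"

definition ground :: "('a \<Rightarrow> real) \<Rightarrow> 'a set" where
  "ground H = {x. \<forall>y. H x \<le> H y}"

definition barPhi :: "('a::finite \<Rightarrow> 'a \<Rightarrow> bool) \<Rightarrow> ('a \<Rightarrow> real) \<Rightarrow> real" where
  "barPhi E H = Max {Phi E H s s' | s s'. s \<in> ground H \<and> s' \<in> ground H}"

definition barOmega :: "('a::finite \<Rightarrow> 'a \<Rightarrow> bool) \<Rightarrow> ('a \<Rightarrow> real) \<Rightarrow> 'a set" where
  "barOmega E H = {x. PhiS E H (ground H) {x} \<le> barPhi E H}"

text \<open>F(A) = argmin of H on A.\<close>
definition Fm :: "('a \<Rightarrow> real) \<Rightarrow> 'a set \<Rightarrow> 'a set" where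
  "Fm H A = {x \<in> A. \<forall>y \<in> A. H x \<le> H y}"

definition bdry :: "('a \<Rightarrow> 'a \<Rightarrow> bool) \<Rightarrow> 'a set \<Rightarrow> 'a set" where
  "bdry E A = {x. x \<notin> A \<and> (\<exists>y \<in> A. E x y)}"

definition bdry_star :: "('a \<Rightarrow> 'a \<Rightarrow> bool) \<Rightarrow> ('a \<Rightarrow> real) \<Rightarrow> 'a set \<Rightarrow> 'a set" where
  "bdry_star E H A = Fm H (bdry E A)"

definition conn_set :: "('a \<Rightarrow> 'a \<Rightarrow> bool) \<Rightarrow> 'a set \<Rightarrow> bool" where
  "conn_set E A \<longleftrightarrow> (\<forall>x \<in> A. \<forall>y \<in> A. \<exists>xs. walk E xs x y \<and> set xs \<subseteq> A)"

definition stable_plateau :: "('a \<Rightarrow> 'a \<Rightarrow> bool) \<Rightarrow> ('a \<Rightarrow> real) \<Rightarrow> 'a set \<Rightarrow> bool" where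
  "stable_plateau E H P \<longleftrightarrow> P \<noteq> {} \<and> conn_set E P \<and> (\<exists>c. \<forall>x \<in> P. H x = c)
     \<and> (\<forall>x \<in> P. \<forall>y \<in> bdry E P. H x < H y)"

definition is_cycle :: "('a \<Rightarrow> 'a \<Rightarrow> bool) \<Rightarrow> ('a \<Rightarrow> real) \<Rightarrow> 'a set \<Rightarrow> bool" where
  "is_cycle E H C \<longleftrightarrow> C \<noteq> {} \<and> conn_set E C \<and> (\<forall>x \<in> C. \<forall>y \<in> bdry E C. H x < H y)"

definition depth :: "('a \<Rightarrow> 'a \<Rightarrow> bool) \<Rightarrow> ('a \<Rightarrow> real) \<Rightarrow> 'a set \<Rightarrow> real" where
  "depth E H C = Min (H ` bdry E C) - Min (H ` C)"

section \<open>General construction (C) for a collection Cs of cycles and threshold G\<close>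

definition Cstar :: "('a \<Rightarrow> 'a \<Rightarrow> bool) \<Rightarrow> ('a \<Rightarrow> real) \<Rightarrow> 'a set set \<Rightarrow> real \<Rightarrow> 'a set set" where
  "Cstar E H Cs G = {C \<in> Cs. depth E H C \<ge> G}"

definition Csharp :: "('a \<Rightarrow> 'a \<Rightarrow> bool) \<Rightarrow> ('a \<Rightarrow> real) \<Rightarrow> 'a set set \<Rightarrow> real \<Rightarrow> 'a set set" where
  "Csharp E H Cs G = {C \<in> Cs. depth E H C < G}"

definition PC :: "('a \<Rightarrow> real) \<Rightarrow> 'a set set \<Rightarrow> 'a set set" where
  "PC H Cs = Fm H ` Cs"

definition PCstar :: "('a \<Rightarrow> 'a \<Rightarrow> bool) \<Rightarrow> ('a \<Rightarrow> real) \<Rightarrow> 'a set set \<Rightarrow> real \<Rightarrow> 'a set set" where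
  "PCstar E H Cs G = Fm H ` Cstar E H Cs G"

definition DeltaC :: "('a::finite \<Rightarrow> 'a \<Rightarrow> bool) \<Rightarrow> ('a \<Rightarrow> real) \<Rightarrow> 'a set set \<Rightarrow> 'a set" where
  "DeltaC E H Cs = barOmega E H - \<Union>Cs"

text \<open>States of the chain on Omega^C: a point eta of Delta is represented by {eta},
  and F(C) by the set F(C) itself (these two kinds never coincide).\<close>
definition DS :: "('a::finite \<Rightarrow> 'a \<Rightarrow> bool) \<Rightarrow> ('a \<Rightarrow> real) \<Rightarrow> 'a set set \<Rightarrow> 'a set set" where
  "DS E H Cs = (\<lambda>x. {x}) ` DeltaC E H Cs"

definition statesC :: "('a::finite \<Rightarrow> 'a \<Rightarrow> bool) \<Rightarrow> ('a \<Rightarrow> real) \<Rightarrow> 'a set set \<Rightarrow> 'a set set" where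
  "statesC E H Cs = DS E H Cs \<union> PC H Cs"

definition rateC :: "('a::finite \<Rightarrow> 'a \<Rightarrow> bool) \<Rightarrow> ('a \<Rightarrow> real) \<Rightarrow> 'a set set \<Rightarrow> real
    \<Rightarrow> 'a set \<Rightarrow> 'a set \<Rightarrow> real" where
  "rateC E H Cs G a b =
    (if a \<in> DS E H Cs \<and> b \<in> DS E H Cs then
       (if E (the_elem a) (the_elem b) \<and> H (the_elem b) \<le> H (the_elem a) then 1 else 0)
     else if a \<in> DS E H Cs \<and> b \<in> PC H Cs then
       (\<Sum>C \<in> {C \<in> Cs. Fm H C = b}.
          if the_elem a \<in> bdry E C then real (card {z \<in> C. E (the_elem a) z}) else 0)
     else if a \<in> PC H Cs \<and> b \<in> DS E H Cs then
       (\<Sum>C \<in> {C \<in> Cs. Fm H C = a}.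
          if depth E H C \<le> G \<and> the_elem b \<in> bdry_star E H C
          then real (card {z \<in> C. E (the_elem b) z}) / real (card (Fm H C)) else 0)
     else 0)"

text \<open>Jump chain of the continuous-time chain (same hitting distribution).\<close>
definition lamC :: "('a::finite \<Rightarrow> 'a \<Rightarrow> bool) \<Rightarrow> ('a \<Rightarrow> real) \<Rightarrow> 'a set set \<Rightarrow> real \<Rightarrow> 'a set \<Rightarrow> real" where
  "lamC E H Cs G a = (\<Sum>b \<in> statesC E H Cs - {a}. rateC E H Cs G a b)"

definition jpC :: "('a::finite \<Rightarrow> 'a \<Rightarrow> bool) \<Rightarrow> ('a \<Rightarrow> real) \<Rightarrow> 'a set set \<Rightarrow> real
    \<Rightarrow> 'a set \<Rightarrow> 'a set \<Rightarrow> real" where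
  "jpC E H Cs G a b = (if lamC E H Cs G a = 0 then 0 else rateC E H Cs G a b / lamC E H Cs G a)"

text \<open>hitn ... t n x = probability, starting from x, that the first visit to P^{C*}
  happens within n jumps and at t.\<close>
fun hitn :: "('a::finite \<Rightarrow> 'a \<Rightarrow> bool) \<Rightarrow> ('a \<Rightarrow> real) \<Rightarrow> 'a set set \<Rightarrow> real
    \<Rightarrow> 'a set \<Rightarrow> nat \<Rightarrow> 'a set \<Rightarrow> real" where
  "hitn E H Cs G t 0 x = (if x = t then 1 else 0)"
| "hitn E H Cs G t (Suc n) x =
     (if x \<in> PCstar E H Cs G then (if x = t then 1 else 0)
      else (\<Sum>y \<in> statesC E H Cs - {x}. jpC E H Cs G x y * hitn E H Cs G t n y))"

text \<open>P_x[ T_t = T_{P^{C*}} < infinity ].\<close>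
definition hitprob :: "('a::finite \<Rightarrow> 'a \<Rightarrow> bool) \<Rightarrow> ('a \<Rightarrow> real) \<Rightarrow> 'a set set \<Rightarrow> real
    \<Rightarrow> 'a set \<Rightarrow> 'a set \<Rightarrow> real" where
  "hitprob E H Cs G t x = lim (\<lambda>n. hitn E H Cs G t n x)"

text \<open>Rates of the trace chain on P^{C*}.\<close>
definition RstarC :: "('a::finite \<Rightarrow> 'a \<Rightarrow> bool) \<Rightarrow> ('a \<Rightarrow> real) \<Rightarrow> 'a set set \<Rightarrow> real
    \<Rightarrow> 'a set \<Rightarrow> 'a set \<Rightarrow> real" where
  "RstarC E H Cs G a b =
     (\<Sum>x \<in> DeltaC E H Cs. rateC E H Cs G a {x} * hitprob E H Cs G b {x})"

definition trace_rel :: "('a::finite \<Rightarrow> 'a \<Rightarrow> bool) \<Rightarrow> ('a \<Rightarrow> real) \<Rightarrow> 'a set set \<Rightarrow> real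
    \<Rightarrow> ('a set \<times> 'a set) set" where
  "trace_rel E H Cs G = {(a, b). a \<in> PCstar E H Cs G \<and> b \<in> PCstar E H Cs G \<and> a \<noteq> b
       \<and> RstarC E H Cs G a b > 0}"

definition comm_class :: "('a::finite \<Rightarrow> 'a \<Rightarrow> bool) \<Rightarrow> ('a \<Rightarrow> real) \<Rightarrow> 'a set set \<Rightarrow> real
    \<Rightarrow> 'a set \<Rightarrow> 'a set set" where
  "comm_class E H Cs G a = {b \<in> PCstar E H Cs G.
       (a, b) \<in> (trace_rel E H Cs G)\<^sup>* \<and> (b, a) \<in> (trace_rel E H Cs G)\<^sup>*}"

text \<open>Closed communicating classes of the trace chain.\<close>
definition closed_classes :: "('a::finite \<Rightarrow> 'a \<Rightarrow> bool) \<Rightarrow> ('a \<Rightarrow> real) \<Rightarrow> 'a set set \<Rightarrow> real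
    \<Rightarrow> 'a set set set" where
  "closed_classes E H Cs G = {K. \<exists>a \<in> PCstar E H Cs G. K = comm_class E H Cs G a \<and>
       (\<forall>x \<in> K. \<forall>y. (x, y) \<in> trace_rel E H Cs G \<longrightarrow> y \<in> K)}"

definition transientP :: "('a::finite \<Rightarrow> 'a \<Rightarrow> bool) \<Rightarrow> ('a \<Rightarrow> real) \<Rightarrow> 'a set set \<Rightarrow> real
    \<Rightarrow> 'a set set" where
  "transientP E H Cs G = PCstar E H Cs G - \<Union>(closed_classes E H Cs G)"

section \<open>The hierarchy\<close>

definition HP :: "('a \<Rightarrow> real) \<Rightarrow> 'a set \<Rightarrow> real" where
  "HP H P = Min (H ` P)"

text \<open>Ph = {P^h_1, ..., P^h_nu}.\<close>
definition GamL :: "('a::finite \<Rightarrow> 'a \<Rightarrow> bool) \<Rightarrow> ('a \<Rightarrow> real) \<Rightarrow> 'a set set \<Rightarrow> 'a set \<Rightarrow> real" where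
  "GamL E H Ph P = PhiS E H P (\<Union>(Ph - {P})) - HP H P"

definition GstarL :: "('a::finite \<Rightarrow> 'a \<Rightarrow> bool) \<Rightarrow> ('a \<Rightarrow> real) \<Rightarrow> 'a set set \<Rightarrow> real" where
  "GstarL E H Ph = Min (GamL E H Ph ` Ph)"

definition VL :: "('a::finite \<Rightarrow> 'a \<Rightarrow> bool) \<Rightarrow> ('a \<Rightarrow> real) \<Rightarrow> 'a set set \<Rightarrow> 'a set \<Rightarrow> 'a set" where
  "VL E H Ph P = {x. PhiS E H P {x} - HP H P < GamL E H Ph P}"

text \<open>carry = C^{*,h-1}_tr union C^{sharp,h-1} (empty at level 1).\<close>
definition CsL :: "('a::finite \<Rightarrow> 'a \<Rightarrow> bool) \<Rightarrow> ('a \<Rightarrow> real) \<Rightarrow> 'a set set \<Rightarrow> 'a set set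
    \<Rightarrow> 'a set set" where
  "CsL E H Ph carry = VL E H Ph ` Ph \<union> {C \<in> carry. \<forall>P \<in> Ph. C \<inter> VL E H Ph P = {}}"

definition stepL :: "('a::finite \<Rightarrow> 'a \<Rightarrow> bool) \<Rightarrow> ('a \<Rightarrow> real) \<Rightarrow> 'a set set \<times> 'a set set
    \<Rightarrow> 'a set set \<times> 'a set set" where
  "stepL E H st =
     (let Ph = fst st; Cs = CsL E H Ph (snd st); G = GstarL E H Ph
      in (Union ` closed_classes E H Cs G,
          {C \<in> Cstar E H Cs G. Fm H C \<in> transientP E H Cs G} \<union> Csharp E H Cs G))"

definition P1 :: "('a::finite \<Rightarrow> 'a \<Rightarrow> bool) \<Rightarrow> ('a \<Rightarrow> real) \<Rightarrow> 'a set set" where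
  "P1 E H = {P. stable_plateau E H P \<and> P \<subseteq> barOmega E H}"

text \<open>lvl E H n = (collection of P^{n+1}_i, C^{*,n}_tr union C^{sharp,n}) i.e. the input data of level n+1.\<close>
primrec lvl :: "('a::finite \<Rightarrow> 'a \<Rightarrow> bool) \<Rightarrow> ('a \<Rightarrow> real) \<Rightarrow> nat \<Rightarrow> 'a set set \<times> 'a set set" where
  "lvl E H 0 = (P1 E H, {})"
| "lvl E H (Suc n) = stepL E H (lvl E H n)"

text \<open>nu E H h = nu_h: nu_0 = number of stable plateaux in bar Omega; for h >= 1,
  the number of closed classes of the trace chain at level h.\<close>
primrec nu :: "('a::finite \<Rightarrow> 'a \<Rightarrow> bool) \<Rightarrow> ('a \<Rightarrow> real) \<Rightarrow> nat \<Rightarrow> nat" where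
  "nu E H 0 = card (P1 E H)"
| "nu E H (Suc n) = card (closed_classes E H
      (CsL E H (fst (lvl E H n)) (snd (lvl E H n))) (GstarL E H (fst (lvl E H n))))"

end

theory Submission
  imports Defs
begin

text \<open>
  Along the jumps of the chain the height at which a state is left never increases. Two consequences
  drive the argument. First, if \<open>F(V)\<close> leads to \<open>F(V')\<close>, then \<open>V\<close> has depth exactly \<open>\<Gamma>\<^sup>\<star>\<close>, the
  communication height between the two does not exceed the exit height of \<open>V\<close>, and the energy of
  \<open>F(V')\<close> is not larger; in particular energies and exit heights are constant on a closed class.
  Second, all states reached from a closed class of cycles of depth \<open>\<Gamma>\<^sup>\<star>\<close> sit at one common level,
  so the chain can follow any path below this level. Hence two different closed classes are separated
  by a barrier strictly larger than \<open>\<Gamma>\<^sup>\<star>\<close>: the depths strictly increase from one level to the next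
  (which keeps the old shallow cycles out of \<open>\<C>\<^sup>\<star>\<close>), and the plateau realising the minimum \<open>\<Gamma>\<^sup>\<star>\<close>
  cannot be a closed class by itself, so the number of classes drops.
\<close>

section \<open>Communication heights\<close>

text \<open>Communicating classes depend only on which rates and hitting probabilities are positive,
  so the probability is turned once and for all into reachability by jumps; after that only heights
  of walks are compared. The obstacle is that closedness of a class concerns \<open>stars\<close>
  alone: a low path may enter a carried shallow cycle or a flat region from which the chain might
  never come back, and then it could not be followed further. Two clauses of the invariant exclude
  this. By \<open>carry_descend\<close>, a carried cycle can be left towards some plateau without
  rising above its exit height; by \<open>plateau_covered\<close>, every stable plateau inside
  \<open>\<Omega>\<close> meets a current cycle. Together they let every state reach some
  \<open>F P\<close>; closedness puts that star into the class, and mutual reachability leads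
  back.\<close>

lemma walk_within_iff:
  "(\<exists>xs. walk E xs x y \<and> set xs \<subseteq> A) \<longleftrightarrow> x \<in> A \<and> (x, y) \<in> {(u, v). E u v \<and> v \<in> A}\<^sup>*"
    (is "?L \<longleftrightarrow> ?R")
proof
  have "x \<in> A \<and> (x, y) \<in> {(u, v). E u v \<and> v \<in> A}\<^sup>*" if "walk E xs x y" "set xs \<subseteq> A" for xs
    using that
  proof (induction xs arbitrary: x)
    case Nil
    then show ?case by (simp add: walk_def)
  next
    case (Cons a xs)
    show ?case
    proof (cases xs)
      case Nil
      with Cons.prems show ?thesis by (auto simp: walk_def)
    next
      case (Cons b ys)
      have "walk E xs b y" "E a b" "a = x"
        using Cons.prems Cons by (auto simp: walk_def)
      moreover have "b \<in> A \<and> (b, y) \<in> {(u, v). E u v \<and> v \<in> A}\<^sup>*"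
        using Cons.IH[OF \<open>walk E xs b y\<close>] Cons.prems by simp
      ultimately show ?thesis
        using Cons.prems by (auto intro: converse_rtrancl_into_rtrancl)
    qed
  qed
  then show "?L \<Longrightarrow> ?R" by blast
next
  assume ?R
  then have "x \<in> A" and "(x, y) \<in> {(u, v). E u v \<and> v \<in> A}\<^sup>*" by auto
  from this(2) show ?L
  proof (induction rule: rtrancl_induct)
    case base
    show ?case using \<open>x \<in> A\<close> by (intro exI[of _ "[x]"]) (simp add: walk_def)
  next
    case (step y z)
    then obtain xs where "walk E xs x y" "set xs \<subseteq> A" by blast
    with step.hyps show ?case
      by (intro exI[of _ "xs @ [z]"]) (auto simp: walk_def successively_append_iff)
  qed
qed

lemma conn_set_iff:
  "conn_set E A \<longleftrightarrow> (\<forall>x \<in> A. \<forall>y \<in> A. (x, y) \<in> {(u, v). E u v \<and> v \<in> A}\<^sup>*)"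
  unfolding conn_set_def walk_within_iff by blast

lemma finite_ex_min:
  fixes f :: "'b \<Rightarrow> real"
  assumes "finite A" "a \<in> A"
  obtains y where "y \<in> A" "\<And>z. z \<in> A \<Longrightarrow> f y \<le> f z"
proof -
  have fin: "finite (f ` A)" and ne: "f ` A \<noteq> {}" using assms by auto
  obtain y where y: "y \<in> A" "f y = Min (f ` A)" using Min_in[OF fin ne] by auto
  show thesis
    by (rule that[OF y(1)]) (simp add: y(2) fin)
qed

locale landscape =
  fixes E :: "'a::finite \<Rightarrow> 'a \<Rightarrow> bool" and H :: "'a \<Rightarrow> real"
  assumes edge_sym: "E x y \<Longrightarrow> E y x"
    and connected: "\<exists>xs. walk E xs x y"
begin

abbreviation \<Phi> :: "'a \<Rightarrow> 'a \<Rightarrow> real" where "\<Phi> \<equiv> Phi E H"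

abbreviation \<Omega> :: "'a set" where "\<Omega> \<equiv> barOmega E H"

text \<open>There are infinitely many walks, but their maxima are values of \<open>H\<close>, so the
  minimum is over a finite nonempty set and is attained. This replaces the minimax by reachability
  inside a sublevel set.\<close>

lemma Phi_le_iff: "\<Phi> x y \<le> c \<longleftrightarrow> H x \<le> c \<and> (x, y) \<in> {(u, v). E u v \<and> H v \<le> c}\<^sup>*"
proof -
  let ?M = "{Max (H ` set xs) | xs. walk E xs x y}"
  have "?M \<subseteq> range H"
  proof
    fix m assume "m \<in> ?M"
    then obtain xs where "walk E xs x y" "m = Max (H ` set xs)" by blast
    then have "m \<in> H ` set xs" using Max_in[of "H ` set xs"] by (simp add: walk_def)
    then show "m \<in> range H" by blast
  qed
  then have "finite ?M" by (rule finite_subset) simp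
  moreover have "?M \<noteq> {}" using connected by blast
  ultimately have "\<Phi> x y \<le> c \<longleftrightarrow> (\<exists>m \<in> ?M. m \<le> c)"
    unfolding Phi_def by (rule Min_le_iff)
  also have "\<dots> \<longleftrightarrow> (\<exists>xs. walk E xs x y \<and> Max (H ` set xs) \<le> c)" by blast
  also have "\<dots> \<longleftrightarrow> (\<exists>xs. walk E xs x y \<and> set xs \<subseteq> {u. H u \<le> c})"
    by (rule ex_cong1) (auto simp: walk_def)
  finally show ?thesis unfolding walk_within_iff by simp
qed

lemma Phi_ge_left: "H x \<le> \<Phi> x y"
  using Phi_le_iff[of x y "\<Phi> x y"] by simp

lemma Phi_refl [simp]: "\<Phi> x x = H x"
  using Phi_le_iff[of x x "H x"] Phi_ge_left[of x x] by simp

lemma Phi_trans: "\<Phi> x y \<le> c \<Longrightarrow> \<Phi> y z \<le> c \<Longrightarrow> \<Phi> x z \<le> c"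
  unfolding Phi_le_iff by auto

lemma Phi_trans_less: "\<Phi> x y < c \<Longrightarrow> \<Phi> y z < c \<Longrightarrow> \<Phi> x z < c"
  using Phi_trans[of x y "max (\<Phi> x y) (\<Phi> y z)" z] by simp

lemma Phi_edge: "E x y \<Longrightarrow> H x \<le> c \<Longrightarrow> H y \<le> c \<Longrightarrow> \<Phi> x y \<le> c"
  unfolding Phi_le_iff by auto

lemma Phi_induct [consumes 1, case_names base step]:
  assumes "\<Phi> x y \<le> c" and "P x"
    and step: "\<And>u v. P u \<Longrightarrow> \<Phi> x u \<le> c \<Longrightarrow> E u v \<Longrightarrow> H v \<le> c \<Longrightarrow> P v"
  shows "P y"
proof -
  from assms(1) have Hx: "H x \<le> c" and "(x, y) \<in> {(u, v). E u v \<and> H v \<le> c}\<^sup>*"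
    unfolding Phi_le_iff by auto
  from this(2) show ?thesis
  proof (induction rule: rtrancl_induct)
    case base
    show ?case by fact
  next
    case (step u v)
    then have "\<Phi> x u \<le> c" using Hx by (simp add: Phi_le_iff)
    with step assms(3) show ?case by blast
  qed
qed

lemma Phi_sym: "\<Phi> x y = \<Phi> y x"
proof -
  have le: "\<Phi> y x \<le> c" if "\<Phi> x y \<le> c" for x y c
    using that
  proof (induction rule: Phi_induct)
    case base
    show ?case using that Phi_ge_left[of x y] by simp
  next
    case (step u v)
    have "H u \<le> c" using step.hyps(1) Phi_ge_left[of u x] step by simp
    then have "\<Phi> v u \<le> c" using step Phi_edge[OF edge_sym, of u v c] by simp
    then show ?case using step Phi_trans[of v u c x] by simp
  qed
  show ?thesis using le[OF order.refl, of x y] le[OF order.refl, of y x] by simp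
qed

lemma Phi_ge_right: "H y \<le> \<Phi> x y"
  using Phi_ge_left[of y x] by (simp add: Phi_sym)

lemma Phi_exit:
  assumes "x \<in> A" "y \<notin> A"
  obtains z where "z \<in> bdry E A" "H z \<le> \<Phi> x y"
proof -
  define c where "c = \<Phi> x y"
  then have "\<Phi> x y \<le> c" by simp
  then have "y \<in> A \<or> (\<exists>z \<in> bdry E A. H z \<le> c)"
  proof (induction rule: Phi_induct)
    case base
    show ?case using assms by simp
  next
    case (step u v)
    then show ?case using edge_sym[of u v] by (auto simp: bdry_def)
  qed
  with assms that c_def show thesis by blast
qed

section \<open>Heights between sets, and the region \<Omega>\<close>

lemma PhiS_le:
  assumes "x \<in> A" "y \<in> B"
  shows "PhiS E H A B \<le> \<Phi> x y"
proof -
  have "{\<Phi> x y | x y. x \<in> A \<and> y \<in> B} = (\<lambda>(x, y). \<Phi> x y) ` (A \<times> B)" by auto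
  then have "finite {\<Phi> x y | x y. x \<in> A \<and> y \<in> B}" by simp
  then show ?thesis unfolding PhiS_def using assms by (intro Min_le) auto
qed

lemma PhiS_attained:
  assumes "A \<noteq> {}" "B \<noteq> {}"
  obtains x y where "x \<in> A" "y \<in> B" "PhiS E H A B = \<Phi> x y"
proof -
  have eq: "{\<Phi> x y | x y. x \<in> A \<and> y \<in> B} = (\<lambda>(x, y). \<Phi> x y) ` (A \<times> B)" by auto
  have "PhiS E H A B \<in> (\<lambda>(x, y). \<Phi> x y) ` (A \<times> B)"
    unfolding PhiS_def eq using assms by (intro Min_in) auto
  then show thesis using that by auto
qed

lemma ground_nonempty: "ground H \<noteq> {}"
proof -
  obtain y where "\<And>z. H y \<le> H z"
    using finite_ex_min[of UNIV undefined H] by auto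
  then show ?thesis by (auto simp: ground_def)
qed

lemma ground_Phi_le:
  assumes "s \<in> ground H" "s' \<in> ground H"
  shows "\<Phi> s s' \<le> barPhi E H"
proof -
  have "{\<Phi> s s' | s s'. s \<in> ground H \<and> s' \<in> ground H}
      = (\<lambda>(x, y). \<Phi> x y) ` (ground H \<times> ground H)" by auto
  then have "finite {\<Phi> s s' | s s'. s \<in> ground H \<and> s' \<in> ground H}" by simp
  then show ?thesis unfolding barPhi_def using assms by (intro Max_ge) auto
qed

lemma barOmega_iff: "x \<in> \<Omega> \<longleftrightarrow> (\<exists>s \<in> ground H. \<Phi> s x \<le> barPhi E H)"
proof
  assume "x \<in> \<Omega>"
  then have "PhiS E H (ground H) {x} \<le> barPhi E H" by (simp add: barOmega_def)
  then show "\<exists>s \<in> ground H. \<Phi> s x \<le> barPhi E H"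
    using PhiS_attained[OF ground_nonempty, of "{x}"] by (metis insert_not_empty singletonD)
next
  assume "\<exists>s \<in> ground H. \<Phi> s x \<le> barPhi E H"
  then obtain s where "s \<in> ground H" "\<Phi> s x \<le> barPhi E H" by blast
  then show "x \<in> \<Omega>"
    using PhiS_le[of s "ground H" x "{x}"] by (simp add: barOmega_def)
qed

text \<open>The two points are linked through ground states, which communicate at height at most
  \<open>barPhi\<close>. With \<open>barOmega_closed\<close> it makes \<open>\<Omega>\<close> one
  component of the sublevel set at \<open>barPhi\<close>.\<close>

lemma barOmega_Phi_le:
  assumes "x \<in> \<Omega>" "y \<in> \<Omega>"
  shows "\<Phi> x y \<le> barPhi E H"
proof -
  obtain s t where s: "s \<in> ground H" "\<Phi> x s \<le> barPhi E H"
    and t: "t \<in> ground H" "\<Phi> t y \<le> barPhi E H"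
    using assms by (auto simp: barOmega_iff Phi_sym)
  have "\<Phi> x t \<le> barPhi E H"
    using s(2) ground_Phi_le[OF s(1) t(1)] by (rule Phi_trans)
  then show ?thesis using t(2) by (rule Phi_trans)
qed

lemma barOmega_closed: "x \<in> \<Omega> \<Longrightarrow> \<Phi> x y \<le> barPhi E H \<Longrightarrow> y \<in> \<Omega>"
  unfolding barOmega_iff using Phi_trans by blast

section \<open>Stable plateaux\<close>

lemma stable_plateau_component:
  assumes "\<And>z. \<Phi> y z \<le> H y \<Longrightarrow> H z = H y"
  shows "stable_plateau E H {z. \<Phi> y z \<le> H y}" (is "stable_plateau E H ?R")
  unfolding stable_plateau_def
proof (intro conjI ballI)
  have "y \<in> ?R" by simp
  then show "?R \<noteq> {}" by blast
  show "\<exists>c. \<forall>x \<in> ?R. H x = c" using assms by blast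
  show "conn_set E ?R" unfolding conn_set_iff
  proof (intro ballI)
    fix u v assume u: "u \<in> ?R" and "v \<in> ?R"
    then have "\<Phi> u y \<le> H y" "\<Phi> y v \<le> H y" by (simp_all add: Phi_sym[of u y])
    then have "\<Phi> u v \<le> H y" by (rule Phi_trans)
    then show "(u, v) \<in> {(a, b). E a b \<and> b \<in> ?R}\<^sup>*"
    proof (induction rule: Phi_induct)
      case base
      show ?case by simp
    next
      case (step a b)
      have "H a \<le> H y" using step.hyps(1) Phi_ge_right[of a u] by simp
      then have "\<Phi> y b \<le> H y"
        using u step Phi_trans[of u a "H y" b] Phi_trans[of y u "H y" b] Phi_edge[of a b "H y"]
        by simp
      with step show ?case by (auto intro: rtrancl_into_rtrancl)
    qed
  qed
  fix x z assume x: "x \<in> ?R" and z: "z \<in> bdry E ?R"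
  then obtain w where w: "z \<notin> ?R" "w \<in> ?R" "E z w" by (auto simp: bdry_def)
  then have "H w \<le> H y" using assms[of w] by simp
  then have "\<not> H z \<le> H y"
    using w Phi_edge[of w z "H y"] edge_sym[of z w] Phi_trans[of y w "H y" z]
    by auto
  then show "H x < H z" using x assms[of x] by simp
qed

text \<open>A lowest point among those reachable without climbing above \<open>H x\<close> has no
  lower point in its own sublevel component, which is therefore a stable plateau. This yields
  \<open>descend\<close> at the first level.\<close>

lemma stable_plateau_below:
  obtains Q y where "stable_plateau E H Q" "y \<in> Q" "\<Phi> x y \<le> H x" "\<And>z. z \<in> Q \<Longrightarrow> \<Phi> x z \<le> H x"
proof -
  obtain y where y: "\<Phi> x y \<le> H x" and min: "\<And>z. \<Phi> x z \<le> H x \<Longrightarrow> H y \<le> H z"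
    using finite_ex_min[of "{y. \<Phi> x y \<le> H x}" x H] by auto
  have Hy: "H y \<le> H x" using min[of x] by simp
  have sub: "\<Phi> x z \<le> H x" if "\<Phi> y z \<le> H y" for z
    using that Hy y Phi_trans[of x y "H x" z] by simp
  have "stable_plateau E H {z. \<Phi> y z \<le> H y}"
    using min[OF sub] Phi_ge_right by (intro stable_plateau_component) (meson order.antisym order.trans)
  then show thesis using that[of "{z. \<Phi> y z \<le> H y}" y] y sub by simp
qed

lemma stable_plateau_Phi_le:
  assumes "stable_plateau E H P" "p \<in> P" "q \<in> P"
  shows "H q = H p" "\<Phi> p q \<le> H p"
proof -
  obtain c where "\<forall>r \<in> P. H r = c" using assms(1) by (auto simp: stable_plateau_def)
  with assms(2) have const: "\<And>r. r \<in> P \<Longrightarrow> H r = H p" by simp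
  then show "H q = H p" using assms by blast
  have "(p, q) \<in> {(u, v). E u v \<and> v \<in> P}\<^sup>*"
    using assms by (simp add: stable_plateau_def conn_set_iff)
  then have "(p, q) \<in> {(u, v). E u v \<and> H v \<le> H p}\<^sup>*"
    by (rule rtrancl_mono[THEN subsetD, rotated]) (auto simp: const)
  then show "\<Phi> p q \<le> H p" by (simp add: Phi_le_iff)
qed

lemma stable_plateau_Phi_gt:
  assumes "stable_plateau E H P" "p \<in> P" "q \<notin> P"
  shows "H p < \<Phi> p q"
proof -
  obtain z where "z \<in> bdry E P" "H z \<le> \<Phi> p q" using Phi_exit[OF assms(2,3)] .
  moreover from this have "H p < H z" using assms by (simp add: stable_plateau_def)
  ultimately show ?thesis by simp
qed

lemma stable_plateau_eqI:
  assumes "stable_plateau E H P" "stable_plateau E H Q" "x \<in> P" "x \<in> Q"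
  shows "P = Q"
proof -
  have "P \<subseteq> Q" if "stable_plateau E H P" "stable_plateau E H Q" "x \<in> P" "x \<in> Q" for P Q
  proof
    fix y assume "y \<in> P"
    then have "\<Phi> x y \<le> H x" using that stable_plateau_Phi_le(2) by blast
    then show "y \<in> Q" using that stable_plateau_Phi_gt[of Q x y] by fastforce
  qed
  with assms show ?thesis by blast
qed

section \<open>Cycles described by heights\<close>

definition exit_height :: "'a set \<Rightarrow> real" where
  "exit_height C = Min (H ` bdry E C)"

text \<open>For proper subsets of the state space this is equivalent to being a cycle, but it is phrased
  through communication heights only.\<close>
definition basin :: "'a set \<Rightarrow> bool" where
  "basin C \<longleftrightarrow> C \<noteq> {} \<and> bdry E C \<noteq> {} \<and> (\<forall>x \<in> C. \<forall>y. y \<in> C \<longleftrightarrow> \<Phi> x y < exit_height C)"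

lemma exit_height_le: "z \<in> bdry E C \<Longrightarrow> exit_height C \<le> H z"
  by (simp add: exit_height_def)

lemma basin_mem_iff: "basin C \<Longrightarrow> x \<in> C \<Longrightarrow> y \<in> C \<longleftrightarrow> \<Phi> x y < exit_height C"
  by (simp add: basin_def)

lemma basin_H_less: "basin C \<Longrightarrow> x \<in> C \<Longrightarrow> H x < exit_height C"
  using basin_mem_iff[of C x x] by simp

lemma basin_nonempty: "basin C \<Longrightarrow> C \<noteq> {}"
  by (simp add: basin_def)

lemma depth_eq: "depth E H C = exit_height C - Min (H ` C)"
  by (simp add: depth_def exit_height_def)

lemma Fm_nonempty: "C \<noteq> {} \<Longrightarrow> Fm H C \<noteq> {}"
proof -
  assume "C \<noteq> {}"
  then obtain x where "x \<in> C" by blast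
  then obtain y where "y \<in> C" "\<And>z. z \<in> C \<Longrightarrow> H y \<le> H z"
    using finite_ex_min[of C x H] by auto
  then show ?thesis by (auto simp: Fm_def)
qed

lemma Fm_subset: "Fm H C \<subseteq> C"
  by (auto simp: Fm_def)

lemma Fm_eq_Min: "x \<in> Fm H C \<Longrightarrow> H x = Min (H ` C)"
  unfolding Fm_def by (intro Min_eqI[symmetric]) auto

lemma Fm_singleton [simp]: "Fm H {x} = {x}"
  by (auto simp: Fm_def)

end

section \<open>The chain of a disjoint family of cycles\<close>

text \<open>The last assumption places the lowest boundary points of each cycle in
  \<open>\<Omega>\<close>, so that leaving a cycle at its exit height does not leave the region on
  which the chain lives.\<close>

locale cycle_chain = landscape E H
  for E :: "'a::finite \<Rightarrow> 'a \<Rightarrow> bool" and H :: "'a \<Rightarrow> real" +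
  fixes Cs :: "'a set set" and G :: real
  assumes Cs_basin: "C \<in> Cs \<Longrightarrow> basin C"
    and Cs_subset: "C \<in> Cs \<Longrightarrow> C \<subseteq> barOmega E H"
    and Cs_disjoint: "C \<in> Cs \<Longrightarrow> D \<in> Cs \<Longrightarrow> x \<in> C \<Longrightarrow> x \<in> D \<Longrightarrow> C = D"
    and Cs_exit_le: "C \<in> Cs \<Longrightarrow> exit_height C \<le> barPhi E H"
begin

abbreviation \<Delta> :: "'a set" where "\<Delta> \<equiv> DeltaC E H Cs"

abbreviation states :: "'a set set" where "states \<equiv> statesC E H Cs"

abbreviation stars :: "'a set set" where "stars \<equiv> PCstar E H Cs G"

abbreviation rate :: "'a set \<Rightarrow> 'a set \<Rightarrow> real" where "rate \<equiv> rateC E H Cs G"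

abbreviation trace :: "('a set \<times> 'a set) set" where "trace \<equiv> trace_rel E H Cs G"

abbreviation classes :: "'a set set set" where "classes \<equiv> closed_classes E H Cs G"

definition block :: "'a \<Rightarrow> 'a set" where
  "block x = {y. y = x \<or> (\<exists>C \<in> Cs. x \<in> C \<and> y \<in> C)}"

text \<open>The state of the chain that represents a point. As \<open>Fm\<close> fixes singletons,
  one formula serves for points of \<open>\<Delta>\<close> and for collapsed cycles.\<close>

definition st :: "'a \<Rightarrow> 'a set" where
  "st x = Fm H (block x)"

text \<open>The height at which the chain leaves the state of a point: it never increases along jumps.\<close>
definition lev :: "'a \<Rightarrow> real" where
  "lev x = (if x \<in> \<Union>Cs then exit_height (block x) else H x)"

text \<open>Marks points whose state has its outgoing rates switched on: those of
  \<open>F(C)\<close> vanish when \<open>C\<close> is deeper than the threshold.\<close>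

definition active :: "'a \<Rightarrow> bool" where
  "active x \<longleftrightarrow> x \<notin> \<Union>Cs \<or> depth E H (block x) \<le> G"

definition jump :: "('a set \<times> 'a set) set" where
  "jump = {(a, b). a \<in> states \<and> b \<in> states \<and> 0 < rate a b}"

text \<open>The hitting recursion is absorbed at \<open>stars\<close>, hence a restriction on the
  source and none on the target.\<close>

definition sjump :: "('a set \<times> 'a set) set" where
  "sjump = {(a, b). (a, b) \<in> jump \<and> a \<notin> stars}"

lemma block_in: "C \<in> Cs \<Longrightarrow> x \<in> C \<Longrightarrow> block x = C"
  unfolding block_def using Cs_disjoint by blast

lemma block_out: "x \<notin> \<Union>Cs \<Longrightarrow> block x = {x}"
  unfolding block_def by auto

lemma st_in: "C \<in> Cs \<Longrightarrow> x \<in> C \<Longrightarrow> st x = Fm H C"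
  by (simp add: st_def block_in)

lemma st_out: "x \<notin> \<Union>Cs \<Longrightarrow> st x = {x}"
  by (simp add: st_def block_out)

lemma lev_in: "C \<in> Cs \<Longrightarrow> x \<in> C \<Longrightarrow> lev x = exit_height C"
  using block_in[of C x] by (auto simp: lev_def)

lemma lev_out: "x \<notin> \<Union>Cs \<Longrightarrow> lev x = H x"
  by (simp add: lev_def)

lemma active_in: "C \<in> Cs \<Longrightarrow> x \<in> C \<Longrightarrow> active x \<longleftrightarrow> depth E H C \<le> G"
  using block_in[of C x] by (auto simp: active_def)

lemma active_out: "x \<notin> \<Union>Cs \<Longrightarrow> active x"
  by (simp add: active_def)

lemma Delta_iff: "x \<in> \<Delta> \<longleftrightarrow> x \<in> \<Omega> \<and> x \<notin> \<Union>Cs"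
  by (simp add: DeltaC_def)

lemma DS_iff: "a \<in> DS E H Cs \<longleftrightarrow> (\<exists>x \<in> \<Delta>. a = {x})"
  by (auto simp: DS_def)

lemma Fm_inj: "C \<in> Cs \<Longrightarrow> D \<in> Cs \<Longrightarrow> Fm H C = Fm H D \<Longrightarrow> C = D"
proof -
  assume C: "C \<in> Cs" "D \<in> Cs" and eq: "Fm H C = Fm H D"
  obtain x where "x \<in> Fm H C" using Fm_nonempty[OF basin_nonempty[OF Cs_basin]] C by blast
  with eq have "x \<in> C" "x \<in> D" using Fm_subset[of C] Fm_subset[of D] by auto
  with C show ?thesis by (rule Cs_disjoint)
qed

lemma Fm_notin_DS: "C \<in> Cs \<Longrightarrow> Fm H C \<notin> DS E H Cs"
  using Fm_subset[of C] by (auto simp: DS_iff Delta_iff)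

lemma same_state: "st x = st y \<Longrightarrow> x = y \<or> (\<exists>C \<in> Cs. x \<in> C \<and> y \<in> C)"
proof -
  assume eq: "st x = st y"
  have "st x \<noteq> {}" unfolding st_def by (rule Fm_nonempty) (auto simp: block_def)
  then obtain z where "z \<in> st x" by blast
  with eq have "z \<in> block x" "z \<in> block y" using Fm_subset unfolding st_def by auto
  then show ?thesis using Cs_disjoint unfolding block_def by blast
qed

lemma states_eq: "states = st ` \<Omega>"
proof
  show "states \<subseteq> st ` \<Omega>"
  proof
    fix a assume "a \<in> states"
    then consider x where "x \<in> \<Delta>" "a = {x}" | C where "C \<in> Cs" "a = Fm H C"
      by (auto simp: statesC_def DS_iff PC_def)
    then show "a \<in> st ` \<Omega>"
    proof cases
      case 1
      then show ?thesis using st_out[of x] by (auto simp: Delta_iff)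
    next
      case 2
      then obtain x where "x \<in> C" using basin_nonempty[OF Cs_basin] by blast
      then show ?thesis using 2 Cs_subset st_in by blast
    qed
  qed
  show "st ` \<Omega> \<subseteq> states"
  proof
    fix a assume "a \<in> st ` \<Omega>"
    then obtain x where x: "x \<in> \<Omega>" "a = st x" by blast
    show "a \<in> states"
    proof (cases "x \<in> \<Union>Cs")
      case True
      then obtain C where "C \<in> Cs" "x \<in> C" by blast
      then show ?thesis using x st_in by (auto simp: statesC_def PC_def)
    next
      case False
      then show ?thesis using x st_out by (auto simp: statesC_def DS_iff Delta_iff)
    qed
  qed
qed

section \<open>Positivity of the rates\<close>

lemma rate_out_out:
  "x \<in> \<Delta> \<Longrightarrow> y \<in> \<Delta> \<Longrightarrow> 0 < rate {x} {y} \<longleftrightarrow> E x y \<and> H y \<le> H x"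
  by (auto simp: rateC_def DS_iff)

lemma rate_out_in:
  assumes "x \<in> \<Delta>" "C \<in> Cs"
  shows "0 < rate {x} (Fm H C) \<longleftrightarrow> x \<in> bdry E C"
proof -
  \<comment> \<open>Disjoint cycles have different bottoms, so the sum in \<open>rateC\<close> has a
    single term.\<close>
  have "{D \<in> Cs. Fm H D = Fm H C} = {C}" using assms Fm_inj by auto
  then have "rate {x} (Fm H C) = (if x \<in> bdry E C then real (card {z \<in> C. E x z}) else 0)"
    unfolding rateC_def using assms Fm_notin_DS by (auto simp: DS_iff PC_def)
  then show ?thesis by (auto simp: bdry_def card_gt_0_iff)
qed

lemma rate_in_out:
  assumes "x \<in> \<Delta>" "C \<in> Cs"
  shows "0 < rate (Fm H C) {x} \<longleftrightarrow> depth E H C \<le> G \<and> x \<in> bdry_star E H C"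
proof -
  have "{D \<in> Cs. Fm H D = Fm H C} = {C}" using assms Fm_inj by auto
  then have "rate (Fm H C) {x} = (if depth E H C \<le> G \<and> x \<in> bdry_star E H C
      then real (card {z \<in> C. E x z}) / real (card (Fm H C)) else 0)"
    unfolding rateC_def using assms Fm_notin_DS by (auto simp: DS_iff PC_def)
  moreover have "Fm H C \<noteq> {}" using Fm_nonempty[OF basin_nonempty[OF Cs_basin]] assms by blast
  moreover have "x \<in> bdry E C" if "x \<in> bdry_star E H C"
    using that Fm_subset[of "bdry E C"] unfolding bdry_star_def by blast
  moreover have "0 < card {z \<in> C. E x z}" if "x \<in> bdry E C"
    using that by (auto simp: bdry_def card_gt_0_iff)
  ultimately show ?thesis by (auto simp: card_gt_0_iff)
qed

lemma rate_in_in: "C \<in> Cs \<Longrightarrow> D \<in> Cs \<Longrightarrow> rate (Fm H C) (Fm H D) = 0"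
  unfolding rateC_def using Fm_notin_DS by auto

lemma rate_nonneg: "0 \<le> rate a b"
  by (auto simp: rateC_def intro!: sum_nonneg)

lemma bdry_star_iff: "x \<in> bdry_star E H C \<longleftrightarrow> x \<in> bdry E C \<and> H x \<le> exit_height C"
proof -
  have "H x \<le> exit_height C \<longleftrightarrow> (\<forall>y \<in> bdry E C. H x \<le> H y)" if "x \<in> bdry E C"
    unfolding exit_height_def using that by (subst Min_ge_iff) auto
  then show ?thesis by (auto simp: bdry_star_def Fm_def)
qed

section \<open>Hitting probabilities reduced to reachability\<close>

lemma jp_pos:
  assumes "b \<in> states" "b \<noteq> a" "0 < rate a b"
  shows "0 < jpC E H Cs G a b"
proof -
  have "rate a b \<le> lamC E H Cs G a"
    unfolding lamC_def using assms by (intro member_le_sum) (auto simp: rate_nonneg)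
  with assms show ?thesis by (simp add: jpC_def)
qed

lemma lam_nonneg: "0 \<le> lamC E H Cs G a"
  by (simp add: lamC_def sum_nonneg rate_nonneg)

lemma jp_nonneg: "0 \<le> jpC E H Cs G a b"
  by (simp add: jpC_def rate_nonneg lam_nonneg)

lemma rate_pos_if_jp_pos: "0 < jpC E H Cs G a b \<Longrightarrow> 0 < rate a b"
  using rate_nonneg[of a b] by (cases "rate a b = 0") (auto simp: jpC_def split: if_splits)

lemma sum_jp_le_1: "(\<Sum>b \<in> states - {a}. jpC E H Cs G a b) \<le> 1"
proof (cases "lamC E H Cs G a = 0")
  case True
  then show ?thesis by (simp add: jpC_def)
next
  case False
  then have "(\<Sum>b \<in> states - {a}. jpC E H Cs G a b)
      = (\<Sum>b \<in> states - {a}. rate a b) / lamC E H Cs G a"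
    by (simp add: jpC_def sum_divide_distrib)
  also have "\<dots> = 1" using False by (simp add: lamC_def)
  finally show ?thesis by simp
qed

lemma hitn_nonneg: "0 \<le> hitn E H Cs G t n a"
  by (induction n arbitrary: a) (auto intro!: sum_nonneg simp: jp_nonneg)

lemma hitn_le_1: "hitn E H Cs G t n a \<le> 1"
proof (induction n arbitrary: a)
  case 0
  show ?case by simp
next
  case (Suc n)
  have "(\<Sum>y \<in> states - {a}. jpC E H Cs G a y * hitn E H Cs G t n y)
      \<le> (\<Sum>y \<in> states - {a}. jpC E H Cs G a y)"
    by (intro sum_mono mult_left_le Suc.IH jp_nonneg)
  then show ?case using sum_jp_le_1[of a] by simp
qed

text \<open>The target must be absorbing: at \<open>n = 0\<close> the value \<open>1\<close> at
  \<open>a = t\<close> survives one more step because \<open>t\<close> is in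
  \<open>stars\<close>.\<close>

lemma hitn_mono:
  assumes "t \<in> stars"
  shows "hitn E H Cs G t n a \<le> hitn E H Cs G t (Suc n) a"
proof (induction n arbitrary: a)
  case 0
  then show ?case using assms by (auto intro!: sum_nonneg simp: jp_nonneg)
next
  case (Suc n)
  show ?case
  proof (cases "a \<in> stars")
    case False
    have "(\<Sum>y \<in> states - {a}. jpC E H Cs G a y * hitn E H Cs G t n y)
      \<le> (\<Sum>y \<in> states - {a}. jpC E H Cs G a y * hitn E H Cs G t (Suc n) y)"
      by (intro sum_mono mult_left_mono Suc.IH jp_nonneg)
    then show ?thesis
      by (subst (1 2) hitn.simps(2)) (simp only: False if_False)
  qed simp
qed

lemma incseq_hitn: "t \<in> stars \<Longrightarrow> incseq (\<lambda>n. hitn E H Cs G t n a)"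
  by (intro incseq_SucI hitn_mono)

lemma hitn_tendsto_hitprob:
  assumes "t \<in> stars"
  shows "(\<lambda>n. hitn E H Cs G t n a) \<longlonglongrightarrow> hitprob E H Cs G t a"
proof -
  have "convergent (\<lambda>n. hitn E H Cs G t n a)"
    using incseq_hitn[OF assms] hitn_le_1 by (metis incseq_convergent convergentI)
  then show ?thesis by (simp add: hitprob_def convergent_LIMSEQ_iff)
qed

lemma hitn_le_hitprob: "t \<in> stars \<Longrightarrow> hitn E H Cs G t n a \<le> hitprob E H Cs G t a"
  using incseq_le[OF incseq_hitn hitn_tendsto_hitprob] by blast

lemma hitprob_nonneg: "t \<in> stars \<Longrightarrow> 0 \<le> hitprob E H Cs G t a"
  using hitn_le_hitprob[of t 0 a] hitn_nonneg[of t 0 a] by simp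

lemma hitprob_pos_iff:
  assumes "t \<in> stars"
  shows "0 < hitprob E H Cs G t a \<longleftrightarrow> (\<exists>n. 0 < hitn E H Cs G t n a)"
proof -
  let ?f = "\<lambda>n. hitn E H Cs G t n a"
  have "hitprob E H Cs G t a = 0" if "\<And>n. \<not> 0 < ?f n"
  proof -
    have "?f = (\<lambda>n. 0)" using that hitn_nonneg[of t _ a] by (intro ext) (meson order.antisym not_less)
    then show ?thesis using hitn_tendsto_hitprob[OF assms] LIMSEQ_unique tendsto_const by metis
  qed
  then show ?thesis using hitn_le_hitprob[OF assms] by (metis less_le_trans less_irrefl)
qed

text \<open>A sum of nonnegative terms is positive exactly when one term is, so unfolding
  \<open>hitn\<close> exhibits the jumps of a path one at a time.\<close>

lemma hitn_pos_iff:
  assumes t: "t \<in> stars" and a: "a \<in> states"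
  shows "(\<exists>n. 0 < hitn E H Cs G t n a) \<longleftrightarrow> (a, t) \<in> sjump\<^sup>*"
proof
  have "(a, t) \<in> sjump\<^sup>*" if "0 < hitn E H Cs G t n a" "a \<in> states" for n
    using that
  proof (induction n arbitrary: a)
    case 0
    then show ?case by (simp split: if_splits)
  next
    case (Suc n)
    show ?case
    proof (cases "a \<in> stars")
      case True
      then show ?thesis using Suc.prems by (simp split: if_splits)
    next
      case False
      then have "0 < (\<Sum>y \<in> states - {a}. jpC E H Cs G a y * hitn E H Cs G t n y)"
        using Suc.prems by simp
      then obtain y where y: "y \<in> states" "0 < jpC E H Cs G a y * hitn E H Cs G t n y"
        by (metis (no_types, lifting) DiffD1 not_less sum_nonpos)
      then have "0 < jpC E H Cs G a y" "0 < hitn E H Cs G t n y"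
        using jp_nonneg[of a y] hitn_nonneg[of t n y] by (auto simp: zero_less_mult_iff)
      then have "(a, y) \<in> sjump" "(y, t) \<in> sjump\<^sup>*"
        using Suc False y rate_pos_if_jp_pos by (auto simp: sjump_def jump_def)
      then show ?thesis by (rule converse_rtrancl_into_rtrancl)
    qed
  qed
  then show "\<exists>n. 0 < hitn E H Cs G t n a \<Longrightarrow> (a, t) \<in> sjump\<^sup>*" using a by blast
next
  assume "(a, t) \<in> sjump\<^sup>*"
  then show "\<exists>n. 0 < hitn E H Cs G t n a"
  proof (induction rule: converse_rtrancl_induct)
    case base
    show ?case by (intro exI[of _ 0]) simp
  next
    case (step a b)
    then obtain n where n: "0 < hitn E H Cs G t n b" by blast
    show ?case
    \<comment> \<open>\<open>hitn\<close> sums over states other than \<open>a\<close>; a jump from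
      \<open>a\<close> to itself is skipped.\<close>
    proof (cases "a = b")
      case True
      then show ?thesis using n by blast
    next
      case False
      have b: "b \<in> states" "0 < rate a b" "a \<notin> stars"
        using step.hyps by (auto simp: sjump_def jump_def)
      have "0 < jpC E H Cs G a b * hitn E H Cs G t n b"
        using jp_pos[of b a] b n False by simp
      also have "\<dots> \<le> (\<Sum>y \<in> states - {a}. jpC E H Cs G a y * hitn E H Cs G t n y)"
        using b False by (intro member_le_sum) (auto simp: jp_nonneg hitn_nonneg)
      finally have "0 < hitn E H Cs G t (Suc n) a" using b by simp
      then show ?thesis by blast
    qed
  qed
qed

section \<open>The trace chain reduced to reachability\<close>

lemma stars_subset_PC: "stars \<subseteq> PC H Cs"
  by (auto simp: PCstar_def PC_def Cstar_def)

lemma trace_iff: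
  "(a, b) \<in> trace \<longleftrightarrow> a \<in> stars \<and> b \<in> stars \<and> a \<noteq> b \<and>
     (\<exists>x \<in> \<Delta>. 0 < rate a {x} \<and> ({x}, b) \<in> sjump\<^sup>*)"
proof -
  have "0 < RstarC E H Cs G a b \<longleftrightarrow> (\<exists>x \<in> \<Delta>. 0 < rate a {x} \<and> ({x}, b) \<in> sjump\<^sup>*)"
    if b: "b \<in> stars"
  proof -
    have hit: "0 < hitprob E H Cs G b {x} \<longleftrightarrow> ({x}, b) \<in> sjump\<^sup>*" if "x \<in> \<Delta>" for x
      using that b hitprob_pos_iff hitn_pos_iff by (auto simp: statesC_def DS_def)
    note nn = hitprob_nonneg[OF b]
    have "0 < RstarC E H Cs G a b
        \<longleftrightarrow> (\<exists>x \<in> \<Delta>. 0 < rate a {x} * hitprob E H Cs G b {x})"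
      unfolding RstarC_def
    proof
      assume "0 < (\<Sum>x \<in> \<Delta>. rate a {x} * hitprob E H Cs G b {x})"
      then show "\<exists>x \<in> \<Delta>. 0 < rate a {x} * hitprob E H Cs G b {x}"
        by (metis (no_types, lifting) not_less sum_nonpos)
    next
      assume "\<exists>x \<in> \<Delta>. 0 < rate a {x} * hitprob E H Cs G b {x}"
      then obtain x where "x \<in> \<Delta>" "0 < rate a {x} * hitprob E H Cs G b {x}" by blast
      then show "0 < (\<Sum>x \<in> \<Delta>. rate a {x} * hitprob E H Cs G b {x})"
        by (intro sum_pos2[of _ x]) (auto simp: nn rate_nonneg)
    qed
    also have "\<dots> \<longleftrightarrow> (\<exists>x \<in> \<Delta>. 0 < rate a {x} \<and> 0 < hitprob E H Cs G b {x})"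
      using rate_nonneg[of a] nn by (simp add: zero_less_mult_iff not_less[symmetric])
    finally show ?thesis using hit by blast
  qed
  then show ?thesis by (auto simp: trace_rel_def)
qed

lemma sjump_rtrancl_subset: "sjump\<^sup>* \<subseteq> jump\<^sup>*"
  by (intro rtrancl_mono) (auto simp: sjump_def)

lemma trace_rtrancl_subset: "trace\<^sup>* \<subseteq> jump\<^sup>*"
proof -
  have "trace \<subseteq> jump\<^sup>*"
  proof (clarify)
    fix a b assume "(a, b) \<in> trace"
    then obtain x where x: "a \<in> stars" "x \<in> \<Delta>" "0 < rate a {x}" "({x}, b) \<in> sjump\<^sup>*"
      by (auto simp: trace_iff)
    then have "(a, {x}) \<in> jump"
      using stars_subset_PC by (auto simp: jump_def statesC_def DS_iff)
    then show "(a, b) \<in> jump\<^sup>*"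
      using x sjump_rtrancl_subset by (meson converse_rtrancl_into_rtrancl subsetD)
  qed
  then show ?thesis by (simp add: rtrancl_subset_rtrancl)
qed

text \<open>The path is cut at its visits to \<open>stars\<close>. Each piece is a step of the trace
  chain: a jump out of a star lands in \<open>\<Delta>\<close>, and \<open>sjump\<close> runs from
  there to the next star.\<close>

lemma jump_rtrancl_trace:
  assumes "(a, b) \<in> jump\<^sup>*" "a \<in> stars" "b \<in> stars"
  shows "(a, b) \<in> trace\<^sup>*"
proof -
  \<comment> \<open>Strengthened to starts outside \<open>stars\<close>, for which the first star
    \<open>c\<close> on the path is recorded.\<close>
  have "(if a \<in> stars then (a, b) \<in> trace\<^sup>*
         else \<exists>c \<in> stars. (a, c) \<in> sjump\<^sup>* \<and> (c, b) \<in> trace\<^sup>*)"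
    using assms(1)
  proof (induction rule: converse_rtrancl_induct)
    case base
    show ?case using assms(3) by simp
  next
    case (step a y)
    show ?case
    proof (cases "a \<in> stars")
      case False
      then have sj: "(a, y) \<in> sjump" using step.hyps by (simp add: sjump_def)
      show ?thesis
      proof (cases "y \<in> stars")
        case True
        then show ?thesis using False sj step.IH by auto
      next
        case y: False
        then obtain c where "c \<in> stars" "(y, c) \<in> sjump\<^sup>*" "(c, b) \<in> trace\<^sup>*"
          using step.IH by auto
        then show ?thesis using False sj by (auto intro: converse_rtrancl_into_rtrancl)
      qed
    next
      case True
      then obtain C where "C \<in> Cs" "a = Fm H C" using stars_subset_PC by (auto simp: PC_def)
      then have "y \<notin> PC H Cs"
        using step.hyps rate_in_in by (auto simp: jump_def PC_def)
      then obtain x where x: "x \<in> \<Delta>" "y = {x}"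
        using step.hyps by (auto simp: jump_def statesC_def DS_iff)
      have "y \<notin> stars" using \<open>y \<notin> PC H Cs\<close> stars_subset_PC by blast
      then obtain c where c: "c \<in> stars" "(y, c) \<in> sjump\<^sup>*" "(c, b) \<in> trace\<^sup>*"
        using step.IH by auto
      have "(a, b) \<in> trace\<^sup>*"
      \<comment> \<open>An excursion that returns to its own star is dropped, since
        \<open>trace\<close> relates distinct stars only.\<close>
      proof (cases "c = a")
        case False
        then have "(a, c) \<in> trace"
          using c True x step.hyps by (auto simp: trace_iff jump_def)
        then show ?thesis using c by (auto intro: converse_rtrancl_into_rtrancl)
      qed (use c in simp)
      then show ?thesis using True by simp
    qed
  qed
  then show ?thesis using assms(2) by simp
qed

section \<open>Levels along jumps and edges\<close>

lemma H_le_lev: "H x \<le> lev x"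
proof (cases "x \<in> \<Union>Cs")
  case True
  then obtain C where "C \<in> Cs" "x \<in> C" by blast
  then show ?thesis using basin_H_less[OF Cs_basin] lev_in by fastforce
qed (simp add: lev_out)

lemma lev_le_barPhi: "x \<in> \<Omega> \<Longrightarrow> lev x \<le> barPhi E H"
proof (cases "x \<in> \<Union>Cs")
  case True
  then obtain C where "C \<in> Cs" "x \<in> C" by blast
  then show ?thesis using Cs_exit_le lev_in by simp
next
  case False
  assume "x \<in> \<Omega>"
  then show ?thesis using False lev_out[of x] barOmega_Phi_le[of x x] by simp
qed

text \<open>A cycle is entered from its boundary, hence from a point at or above its exit
  height.\<close>

lemma lev_edge:
  assumes "E u v" "H v \<le> lev u"
  shows "lev v \<le> lev u"
proof (cases "v \<in> \<Union>Cs")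
  case True
  then obtain C where C: "C \<in> Cs" "v \<in> C" by blast
  show ?thesis
  proof (cases "u \<in> C")
    case True
    then show ?thesis using C lev_in by simp
  next
    case False
    then have "exit_height C \<le> H u" using C assms by (intro exit_height_le) (auto simp: bdry_def)
    then show ?thesis using C lev_in[of C v] H_le_lev[of u] by simp
  qed
next
  case False
  then show ?thesis using assms lev_out[of v] by simp
qed

lemma same_state_le:
  assumes "st x = st y"
  shows "lev x = lev y" "\<Phi> x y \<le> lev x" "active x \<longleftrightarrow> active y"
proof -
  from same_state[OF assms]
  consider "x = y" | C where "C \<in> Cs" "x \<in> C" "y \<in> C" by blast
  then have "lev x = lev y \<and> \<Phi> x y \<le> lev x \<and> (active x \<longleftrightarrow> active y)"
  proof cases
    case 1
    then show ?thesis by (simp add: H_le_lev)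
  next
    case 2
    then have "\<Phi> x y < exit_height C" using basin_mem_iff[OF Cs_basin] by blast
    with 2 show ?thesis by (simp add: lev_in active_in)
  qed
  then show "lev x = lev y" "\<Phi> x y \<le> lev x" "active x \<longleftrightarrow> active y" by auto
qed

text \<open>Lifts a jump to an edge of the graph. The member from which a collapsed cycle is left is
  not determined by the state, so the edge starts at some \<open>u\<close> sharing the state of
  \<open>x\<close>.\<close>

lemma jump_edgeE:
  assumes "x \<in> \<Omega>" "(st x, b) \<in> jump"
  obtains u v where "st u = st x" "st v = b" "v \<in> \<Omega>" "E u v" "H v \<le> lev u" "active u"
proof -
  from assms obtain y where y: "y \<in> \<Omega>" "b = st y" and pos: "0 < rate (st x) (st y)"
    by (auto simp: jump_def states_eq)
  show thesis
  proof (cases "x \<in> \<Union>Cs")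
    case True
    then obtain C where C: "C \<in> Cs" "x \<in> C" by blast
    have "y \<notin> \<Union>Cs"
    proof
      assume "y \<in> \<Union>Cs"
      then obtain D where "D \<in> Cs" "y \<in> D" by blast
      then show False using pos C st_in rate_in_in by simp
    qed
    then have "depth E H C \<le> G" and star: "y \<in> bdry_star E H C"
      using pos y C st_in[of C x] st_out[of y] rate_in_out[of y C] by (auto simp: Delta_iff)
    moreover obtain z where "z \<in> C" "E y z" using star by (auto simp: bdry_star_iff bdry_def)
    ultimately show thesis
      using that[of z y] C y st_in lev_in active_in edge_sym by (simp add: bdry_star_iff)
  next
    case x: False
    then have act: "active x" "lev x = H x" "x \<in> \<Delta>" "st x = {x}"
      using assms active_out lev_out st_out by (auto simp: Delta_iff)
    show thesis
    proof (cases "y \<in> \<Union>Cs")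
      case True
      then obtain C where C: "C \<in> Cs" "y \<in> C" by blast
      then have bd: "x \<in> bdry E C" using pos act rate_out_in st_in by simp
      then obtain z where z: "z \<in> C" "E x z" by (auto simp: bdry_def)
      have "H z < exit_height C" using C z basin_H_less[OF Cs_basin] by blast
      also have "\<dots> \<le> H x" using bd by (rule exit_height_le)
      finally show thesis
        using that[of x z] z C act y st_in[of C] Cs_subset[of C] by auto
    next
      case False
      then show thesis
        using that[of x y] act y pos rate_out_out[of x y] st_out[of y] by (auto simp: Delta_iff)
    qed
  qed
qed

text \<open>Converse of \<open>jump_edgeE\<close>; the closure in the conclusion absorbs edges
  inside a cycle, which produce no jump.\<close>

lemma edge_jump:
  assumes "x \<in> \<Omega>" "y \<in> \<Omega>" "E x y" "H y \<le> lev x" "active x"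
  shows "(st x, st y) \<in> jump\<^sup>*"
proof -
  have j: "(st x, st y) \<in> jump" if "0 < rate (st x) (st y)"
    using that assms by (auto simp: jump_def states_eq)
  show ?thesis
  proof (cases "x \<in> \<Union>Cs")
    case True
    then obtain C where C: "C \<in> Cs" "x \<in> C" by blast
    show ?thesis
    proof (cases "y \<in> C")
      case True
      then show ?thesis using C st_in by simp
    next
      case False
      then have y: "y \<in> bdry E C" using C assms edge_sym[of x y] by (auto simp: bdry_def)
      \<comment> \<open>Two cycles of the family are never adjacent: each of the two points would
        lie at or above the exit height of the other's cycle, yet below that of its own.\<close>
      have "y \<notin> \<Union>Cs"
      proof
        assume "y \<in> \<Union>Cs"
        then obtain D where D: "D \<in> Cs" "y \<in> D" by blast
        then have "x \<notin> D" using C False Cs_disjoint by blast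
        then have "exit_height D \<le> H x"
          using D assms by (intro exit_height_le) (auto simp: bdry_def)
        also have "\<dots> < exit_height C" using C basin_H_less[OF Cs_basin] by blast
        also have "\<dots> \<le> H y" using y by (rule exit_height_le)
        finally show False using D basin_H_less[OF Cs_basin, of D y] by simp
      qed
      moreover have "y \<in> bdry_star E H C" using y assms(4) C lev_in by (simp add: bdry_star_iff)
      ultimately have "0 < rate (st x) (st y)"
        using C assms active_in[of C x] st_in[of C x] st_out[of y] rate_in_out[of y C]
        by (simp add: Delta_iff)
      then show ?thesis using j by blast
    qed
  next
    case x: False
    then have D: "x \<in> \<Delta>" "st x = {x}" "lev x = H x" using assms st_out lev_out by (auto simp: Delta_iff)
    have "0 < rate (st x) (st y)"
    proof (cases "y \<in> \<Union>Cs")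
      case True
      then obtain C where C: "C \<in> Cs" "y \<in> C" by blast
      then have "x \<in> bdry E C" using x assms by (auto simp: bdry_def)
      then show ?thesis using D C st_in rate_out_in by simp
    next
      case False
      then show ?thesis using D assms st_out[of y] rate_out_out[of x y] by (simp add: Delta_iff)
    qed
    then show ?thesis using j by blast
  qed
qed

lemma jump_rtrancl_le:
  assumes "x \<in> \<Omega>" "(st x, st y) \<in> jump\<^sup>*"
  shows "lev y \<le> lev x" "\<Phi> x y \<le> lev x"
proof -
  \<comment> \<open>The induction carries a representative of the current state, since consecutive
    edges may use different members of a cycle; moving between these stays below its exit
    height.\<close>
  have "\<exists>u \<in> \<Omega>. b = st u \<and> lev u \<le> lev x \<and> \<Phi> x u \<le> lev x"
    if "(st x, b) \<in> jump\<^sup>*" for b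
    using that
  proof (induction rule: rtrancl_induct)
    case base
    show ?case using assms(1) H_le_lev[of x] by (intro bexI[of _ x]) auto
  next
    case (step b c)
    then obtain w where w: "w \<in> \<Omega>" "b = st w" "lev w \<le> lev x" "\<Phi> x w \<le> lev x" by blast
    then obtain u v where uv: "st u = st w" "st v = c" "v \<in> \<Omega>" "E u v" "H v \<le> lev u"
      using step.hyps(2) jump_edgeE[of w c] by blast
    have u: "lev u = lev w" "\<Phi> w u \<le> lev w" using same_state_le[of w u] uv(1) by auto
    have "\<Phi> x u \<le> lev x" using Phi_trans[of x w "lev x" u] w u by simp
    moreover have "\<Phi> u v \<le> lev x"
      using uv u w H_le_lev[of u] by (intro Phi_edge) auto
    ultimately have "\<Phi> x v \<le> lev x" by (rule Phi_trans)
    moreover have "lev v \<le> lev x" using lev_edge[OF uv(4,5)] u w by simp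
    ultimately show ?case using uv by blast
  qed
  from this[OF assms(2)] obtain u
    where u: "st y = st u" "lev u \<le> lev x" "\<Phi> x u \<le> lev x" by blast
  have "lev y = lev u" "\<Phi> u y \<le> lev u" using same_state_le[of u y] u by auto
  then show "lev y \<le> lev x" "\<Phi> x y \<le> lev x"
    using u Phi_trans[of x u "lev x" y] by auto
qed

text \<open>In general a low path may cross a state whose level has dropped below the next point, or
  whose rates are switched off, and the chain cannot follow. \<open>flat\<close> excludes both, so
  \<open>edge_jump\<close> applies to every edge.\<close>

lemma Phi_le_lev_imp_jump:
  assumes x: "x \<in> \<Omega>"
    and flat: "\<And>y. y \<in> \<Omega> \<Longrightarrow> (st x, st y) \<in> jump\<^sup>* \<Longrightarrow> lev y = lev x \<and> active y"
    and "\<Phi> x z \<le> lev x"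
  shows "z \<in> \<Omega> \<and> (st x, st z) \<in> jump\<^sup>*"
  using assms(3)
proof (induction rule: Phi_induct)
  case base
  show ?case using x by simp
next
  case (step u v)
  have u: "lev u = lev x" "active u" using flat step by auto
  have "\<Phi> u v \<le> lev x" using step u H_le_lev[of u] by (intro Phi_edge) auto
  with \<open>\<Phi> x u \<le> lev x\<close> have "\<Phi> x v \<le> lev x" by (rule Phi_trans)
  then have v: "v \<in> \<Omega>"
    using barOmega_closed[OF x, of v] lev_le_barPhi[OF x] by simp
  then have "(st u, st v) \<in> jump\<^sup>*" using step u by (intro edge_jump) auto
  then show ?case using v step by auto
qed

lemma jump_rtrancl_active:
  assumes "x \<in> \<Omega>" "(st x, b) \<in> jump\<^sup>*" "b \<noteq> st x"
  shows "active x"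
proof -
  obtain c where "(st x, c) \<in> jump" using assms(2,3) by (auto elim: converse_rtranclE)
  with assms(1) obtain u v where "st u = st x" "active u" by (rule jump_edgeE)
  then show ?thesis using same_state_le(3) by blast
qed

section \<open>Closed classes\<close>

lemma trace_rtrancl_stars: "(a, b) \<in> trace\<^sup>* \<Longrightarrow> a \<in> stars \<Longrightarrow> b \<in> stars"
  by (induction rule: rtrancl_induct) (auto simp: trace_iff)

lemma classesE:
  assumes "K \<in> classes"
  obtains a where "a \<in> stars" "K = {b \<in> stars. (a, b) \<in> trace\<^sup>* \<and> (b, a) \<in> trace\<^sup>*}"
    "\<And>x y. x \<in> K \<Longrightarrow> (x, y) \<in> trace \<Longrightarrow> y \<in> K"
proof -
  obtain a where "a \<in> stars" "K = comm_class E H Cs G a"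
    "\<forall>x \<in> K. \<forall>y. (x, y) \<in> trace \<longrightarrow> y \<in> K"
    using assms by (auto simp: closed_classes_def)
  then show thesis using that[of a] unfolding comm_class_def by blast
qed

lemma class_subset: "K \<in> classes \<Longrightarrow> K \<subseteq> stars"
  by (erule classesE) blast

lemma class_nonempty: "K \<in> classes \<Longrightarrow> K \<noteq> {}"
  by (erule classesE) blast

lemma class_eqI:
  assumes "K \<in> classes" "L \<in> classes" "a \<in> K" "a \<in> L"
  shows "K = L"
proof -
  obtain k where k: "K = {b \<in> stars. (k, b) \<in> trace\<^sup>* \<and> (b, k) \<in> trace\<^sup>*}"
    using assms(1) by (rule classesE)
  obtain l where l: "L = {b \<in> stars. (l, b) \<in> trace\<^sup>* \<and> (b, l) \<in> trace\<^sup>*}"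
    using assms(2) by (rule classesE)
  have "(k, l) \<in> trace\<^sup>*" "(l, k) \<in> trace\<^sup>*"
    using assms(3,4) unfolding k l by (auto intro: rtrancl_trans)
  then show ?thesis unfolding k l by (auto intro: rtrancl_trans)
qed

lemma class_closed:
  assumes "K \<in> classes" "a \<in> K" "(a, b) \<in> jump\<^sup>*" "b \<in> stars"
  shows "b \<in> K"
proof -
  have "(a, b) \<in> trace\<^sup>*"
    using assms class_subset by (intro jump_rtrancl_trace) auto
  then show ?thesis
  proof (induction rule: rtrancl_induct)
    case base
    show ?case by fact
  next
    case (step y z)
    from assms(1) show ?case by (rule classesE) (use step in blast)
  qed
qed

lemma class_mutual:
  assumes "K \<in> classes" "a \<in> K" "b \<in> K"
  shows "(a, b) \<in> jump\<^sup>*"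
proof -
  obtain k where "K = {b \<in> stars. (k, b) \<in> trace\<^sup>* \<and> (b, k) \<in> trace\<^sup>*}"
    using assms(1) by (rule classesE)
  then have "(a, b) \<in> trace\<^sup>*" using assms by (auto intro: rtrancl_trans)
  then show ?thesis using trace_rtrancl_subset by blast
qed

text \<open>A descendant of \<open>a\<close> with the smallest set of descendants is reachable back
  from each of them, so its communicating class is closed.\<close>

lemma class_reached:
  assumes "a \<in> stars"
  obtains K b where "K \<in> classes" "b \<in> K" "(a, b) \<in> jump\<^sup>*"
proof -
  let ?R = "\<lambda>b. {c. (b, c) \<in> trace\<^sup>*}"
  obtain b where b: "(a, b) \<in> trace\<^sup>*"
    and min: "\<And>c. (a, c) \<in> trace\<^sup>* \<Longrightarrow> card (?R b) \<le> card (?R c)"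
    using finite_ex_min[of "?R a" a "\<lambda>b. real (card (?R b))"] by auto
  have returns: "(c, b) \<in> trace\<^sup>*" if "(b, c) \<in> trace\<^sup>*" for c
  proof -
    have "?R c \<subseteq> ?R b" using that by auto
    moreover have "card (?R b) \<le> card (?R c)" using that b by (intro min) auto
    ultimately have "?R c = ?R b" by (intro card_seteq) auto
    then show ?thesis by blast
  qed
  have bs: "b \<in> stars" using trace_rtrancl_stars[OF b assms] .
  have "comm_class E H Cs G b \<in> classes"
    unfolding closed_classes_def
  proof (intro CollectI bexI[OF _ bs] conjI refl ballI allI impI)
    fix x y assume "x \<in> comm_class E H Cs G b" and xy: "(x, y) \<in> trace"
    then have "(b, y) \<in> trace\<^sup>*" by (auto simp: comm_class_def intro: rtrancl_into_rtrancl)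
    moreover have "y \<in> stars" using xy by (simp add: trace_iff)
    ultimately show "y \<in> comm_class E H Cs G b" using returns by (simp add: comm_class_def)
  qed
  moreover have "b \<in> comm_class E H Cs G b" using bs by (simp add: comm_class_def)
  ultimately show thesis using that b trace_rtrancl_subset by blast
qed

end

section \<open>One level of the hierarchy\<close>

text \<open>The invariant of the hierarchy. The threshold \<open>g\<close> is the value of \<open>\<Gamma>\<^sup>\<star>\<close> at the
  previous level, and \<open>0\<close> at the first one. Since the depths \<open>\<Gamma>\<^sub>i\<close> exceed \<open>g\<close> while the carried
  cycles have depth at most \<open>g\<close>, only the \<open>V\<^sub>i\<close> survive in \<open>\<C>\<^sup>\<star>\<close>.\<close>
locale hierarchy_level = landscape E H
  for E :: "'a::finite \<Rightarrow> 'a \<Rightarrow> bool" and H :: "'a \<Rightarrow> real" +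
  fixes Ph carry :: "'a set set" and g :: real
  assumes card_Ph: "2 \<le> card Ph"
    and g_nonneg: "0 \<le> g"
    and Ph_nonempty: "P \<in> Ph \<Longrightarrow> P \<noteq> {}"
    and Ph_subset: "P \<in> Ph \<Longrightarrow> P \<subseteq> barOmega E H"
    and Ph_H_eq: "P \<in> Ph \<Longrightarrow> p \<in> P \<Longrightarrow> q \<in> P \<Longrightarrow> H q = H p"
    and Ph_Phi_le: "P \<in> Ph \<Longrightarrow> p \<in> P \<Longrightarrow> q \<in> P \<Longrightarrow> Phi E H p q \<le> H p + g"
    and Ph_Phi_gt: "P \<in> Ph \<Longrightarrow> Q \<in> Ph \<Longrightarrow> P \<noteq> Q \<Longrightarrow> p \<in> P \<Longrightarrow> q \<in> Q \<Longrightarrow> H p + g < Phi E H p q"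
    and descend: "x \<in> barOmega E H \<Longrightarrow> \<exists>P \<in> Ph. \<exists>p \<in> P. Phi E H x p \<le> H x + g \<and> H p \<le> H x"
    and carry_basin: "C \<in> carry \<Longrightarrow> basin C"
    and carry_subset: "C \<in> carry \<Longrightarrow> C \<subseteq> barOmega E H"
    and carry_depth: "C \<in> carry \<Longrightarrow> depth E H C \<le> g"
    and carry_descend: "C \<in> carry \<Longrightarrow> \<exists>P \<in> Ph. \<exists>p \<in> P. \<exists>x \<in> C. Phi E H x p \<le> exit_height C"
    and carry_disjoint: "C \<in> carry \<Longrightarrow> D \<in> carry \<Longrightarrow> x \<in> C \<Longrightarrow> x \<in> D \<Longrightarrow> C = D"
    and plateau_covered: "stable_plateau E H Q \<Longrightarrow> Q \<subseteq> barOmega E H \<Longrightarrow>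
      \<exists>x \<in> Q. x \<in> \<Union>carry \<or> (\<exists>P \<in> Ph. x \<in> VL E H Ph P)"
begin

abbreviation V :: "'a set \<Rightarrow> 'a set" where "V \<equiv> VL E H Ph"

abbreviation \<Gamma> :: "'a set \<Rightarrow> real" where "\<Gamma> \<equiv> GamL E H Ph"

abbreviation \<Gamma>star :: real where "\<Gamma>star \<equiv> GstarL E H Ph"

abbreviation Cs :: "'a set set" where "Cs \<equiv> CsL E H Ph carry"

abbreviation ext :: "'a set \<Rightarrow> real" where "ext P \<equiv> PhiS E H P (\<Union>(Ph - {P}))"

abbreviation F :: "'a set \<Rightarrow> 'a set" where "F P \<equiv> Fm H (V P)"

section \<open>The sets V and their exit heights\<close>

lemma ex_other: "\<exists>Q \<in> Ph. Q \<noteq> P"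
proof (rule ccontr)
  assume "\<not> ?thesis"
  then have "Ph \<subseteq> {P}" by auto
  then have "card Ph \<le> 1" using card_mono[of "{P}" Ph] by simp
  with card_Ph show False by simp
qed

lemma HP_eq: "P \<in> Ph \<Longrightarrow> p \<in> P \<Longrightarrow> HP H P = H p"
proof -
  assume P: "P \<in> Ph" "p \<in> P"
  then have "H ` P = (\<lambda>_. H p) ` P" using Ph_H_eq by (intro image_cong refl)
  also have "\<dots> = {H p}" using P by blast
  finally show ?thesis by (simp add: HP_def)
qed

lemma ext_le: "P \<in> Ph \<Longrightarrow> Q \<in> Ph \<Longrightarrow> P \<noteq> Q \<Longrightarrow> p \<in> P \<Longrightarrow> q \<in> Q \<Longrightarrow> ext P \<le> \<Phi> p q"
  by (intro PhiS_le) auto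

lemma ext_attained:
  assumes "P \<in> Ph"
  obtains p Q q where "p \<in> P" "Q \<in> Ph" "Q \<noteq> P" "q \<in> Q" "ext P = \<Phi> p q"
proof -
  obtain Q where "Q \<in> Ph" "Q \<noteq> P" using ex_other[of P] by blast
  moreover from this have "Q \<noteq> {}" using Ph_nonempty by blast
  ultimately have "\<Union>(Ph - {P}) \<noteq> {}" by blast
  with Ph_nonempty[OF assms] obtain p q
    where "p \<in> P" "q \<in> \<Union>(Ph - {P})" "ext P = \<Phi> p q" by (rule PhiS_attained)
  then show thesis using that by blast
qed

lemma ext_gt:
  assumes "P \<in> Ph" "p \<in> P"
  shows "H p + g < ext P"
proof -
  obtain p' Q q where a: "p' \<in> P" "Q \<in> Ph" "Q \<noteq> P" "q \<in> Q" "ext P = \<Phi> p' q"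
    using assms(1) by (rule ext_attained)
  then have "H p' + g < ext P" using Ph_Phi_gt[of P Q p' q] assms by simp
  then show ?thesis using Ph_H_eq[OF assms(1) a(1) assms(2)] by simp
qed

lemma Gamma_eq: "\<Gamma> P = ext P - HP H P"
  by (simp add: GamL_def)

text \<open>Points of \<open>P\<close> communicate at height at most \<open>H p + g\<close>,
  strictly below \<open>ext P\<close>, so the minimum over \<open>P\<close> may be replaced by any
  single \<open>p\<close>.\<close>

lemma V_iff:
  assumes "P \<in> Ph" "p \<in> P"
  shows "x \<in> V P \<longleftrightarrow> \<Phi> p x < ext P"
proof -
  have V: "x \<in> V P \<longleftrightarrow> PhiS E H P {x} < ext P" by (auto simp: VL_def Gamma_eq)
  have "PhiS E H P {x} \<le> \<Phi> p x" using assms by (intro PhiS_le) auto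
  moreover have "\<Phi> p x < ext P" if lt: "PhiS E H P {x} < ext P"
  proof -
    have "{x} \<noteq> {}" by simp
    with Ph_nonempty[OF assms(1)] obtain p' y
      where p': "p' \<in> P" "y \<in> {x}" "PhiS E H P {x} = \<Phi> p' y" by (rule PhiS_attained)
    have "\<Phi> p p' < ext P" using Ph_Phi_le[OF assms p'(1)] ext_gt[OF assms] by simp
    moreover have "\<Phi> p' x < ext P" using p' lt by simp
    ultimately show ?thesis by (rule Phi_trans_less)
  qed
  ultimately show ?thesis using V by auto
qed

lemma P_subset_V: "P \<in> Ph \<Longrightarrow> P \<subseteq> V P"
proof
  fix p assume "P \<in> Ph" "p \<in> P"
  then show "p \<in> V P" using V_iff[of P p p] ext_gt[of P p] g_nonneg by simp
qed

text \<open>The descent from \<open>x\<close> ends in a member of \<open>Ph\<close> that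
  \<open>p\<close> reaches below \<open>ext P\<close>, hence in \<open>P\<close> itself. This
  identifies the bottom energy of \<open>V P\<close> and ties all its lowest points to
  \<open>P\<close>.\<close>

lemma V_H_ge:
  assumes "P \<in> Ph" "p \<in> P" "x \<in> V P" "x \<in> \<Omega>" "H x \<le> H p"
  shows "H x = H p" "\<Phi> p x \<le> H p + g"
proof -
  obtain Q q where q: "Q \<in> Ph" "q \<in> Q" "\<Phi> x q \<le> H x + g" "H q \<le> H x"
    using descend[OF assms(4)] by blast
  have "\<Phi> x q < ext P" using q(3) assms(5) ext_gt[OF assms(1,2)] by simp
  moreover have "\<Phi> p x < ext P" using V_iff assms by blast
  ultimately have "\<Phi> p q < ext P" by (rule Phi_trans_less[rotated])
  then have "Q = P" using ext_le[of P Q p q] assms q by fastforce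
  then have Hq: "H q = H p" "\<Phi> p q \<le> H p + g"
    using Ph_H_eq[of P p q] Ph_Phi_le[of P p q] assms q by auto
  then show "H x = H p" using q(4) assms(5) by simp
  then have "\<Phi> q x \<le> H p + g" using q(3) Phi_sym[of x q] by simp
  then show "\<Phi> p x \<le> H p + g" using Hq(2) Phi_trans by blast
qed

text \<open>A common point would join \<open>P\<close> and \<open>Q\<close> below the larger of
  their exit heights, while neither of these exceeds the barrier between them.\<close>

lemma V_disjoint:
  assumes "P \<in> Ph" "Q \<in> Ph" "x \<in> V P" "x \<in> V Q"
  shows "P = Q"
proof (rule ccontr)
  assume ne: "P \<noteq> Q"
  obtain p q where pq: "p \<in> P" "q \<in> Q" using Ph_nonempty assms by blast
  have "\<Phi> p x < ext P" "\<Phi> q x < ext Q" using V_iff assms pq by blast+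
  then have "\<Phi> p x < max (ext P) (ext Q)" "\<Phi> x q < max (ext P) (ext Q)"
    by (simp_all add: Phi_sym[of x q])
  then have "\<Phi> p q < max (ext P) (ext Q)" by (rule Phi_trans_less)
  moreover have "ext P \<le> \<Phi> p q" "ext Q \<le> \<Phi> q p" using ext_le assms pq ne by auto
  ultimately show False using Phi_sym[of p q] by simp
qed

lemma V_subset: "P \<in> Ph \<Longrightarrow> V P \<subseteq> \<Omega>"
proof
  fix x assume P: "P \<in> Ph" and x: "x \<in> V P"
  obtain p Q q where a: "p \<in> P" "Q \<in> Ph" "q \<in> Q" "ext P = \<Phi> p q"
    using P by (rule ext_attained)
  then have \<Omega>: "p \<in> \<Omega>" "q \<in> \<Omega>" using Ph_subset P by auto
  have "\<Phi> p x < ext P" using V_iff P a x by blast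
  also have "\<dots> \<le> barPhi E H" using a barOmega_Phi_le[OF \<Omega>] by simp
  finally show "x \<in> \<Omega>" using barOmega_closed \<Omega> by auto
qed

text \<open>An optimal path to another member of \<open>Ph\<close> must leave \<open>V P\<close>,
  which bounds the exit height by \<open>ext P\<close>; a boundary point below \<open>ext P\<close>
  would already belong to \<open>V P\<close>.\<close>

lemma V_exit:
  assumes "P \<in> Ph"
  shows "bdry E (V P) \<noteq> {}" "exit_height (V P) = ext P"
proof -
  obtain p Q q where a: "p \<in> P" "Q \<in> Ph" "Q \<noteq> P" "q \<in> Q" "ext P = \<Phi> p q"
    using assms by (rule ext_attained)
  have "p \<in> V P" using assms a P_subset_V by blast
  moreover have "q \<notin> V P" using V_iff[OF assms a(1)] a(5) by simp
  ultimately obtain z where z: "z \<in> bdry E (V P)" "H z \<le> ext P"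
    unfolding a(5) by (rule Phi_exit)
  then show "bdry E (V P) \<noteq> {}" by blast
  have ge: "ext P \<le> H w" if w: "w \<in> bdry E (V P)" for w
  proof (rule ccontr)
    assume "\<not> ext P \<le> H w"
    moreover obtain y where y: "y \<in> V P" "E w y" "w \<notin> V P" using w by (auto simp: bdry_def)
    have "\<Phi> p y < ext P" using V_iff[OF assms a(1)] y by blast
    moreover from this have "H y < ext P" using Phi_ge_right[of y p] by simp
    ultimately have "\<Phi> y w < ext P"
      using Phi_edge[OF edge_sym[OF y(2)], of "max (H y) (H w)"] by simp
    with \<open>\<Phi> p y < ext P\<close> have "\<Phi> p w < ext P" by (rule Phi_trans_less)
    then show False using V_iff[OF assms a(1)] y by blast
  qed
  show "exit_height (V P) = ext P"
    unfolding exit_height_def using z ge by (intro Min_eqI) (auto intro: order.antisym)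
qed

lemma V_basin:
  assumes "P \<in> Ph"
  shows "basin (V P)"
  unfolding basin_def
proof (intro conjI ballI allI)
  obtain p where p: "p \<in> P" using Ph_nonempty assms by blast
  then show "V P \<noteq> {}" using P_subset_V assms by blast
  show "bdry E (V P) \<noteq> {}" using V_exit assms by blast
  fix x y assume "x \<in> V P"
  then have x: "\<Phi> p x < ext P" using V_iff[OF assms p] by simp
  have "\<Phi> p y < ext P \<longleftrightarrow> \<Phi> x y < ext P"
    using x Phi_trans_less[of p x "ext P" y] Phi_trans_less[of x p "ext P" y] Phi_sym[of x p]
    by auto
  then show "y \<in> V P \<longleftrightarrow> \<Phi> x y < exit_height (V P)"
    using V_iff[OF assms p] V_exit[OF assms] by simp
qed

lemma Min_V: "P \<in> Ph \<Longrightarrow> Min (H ` V P) = HP H P"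
proof -
  assume P: "P \<in> Ph"
  obtain p where p: "p \<in> P" using Ph_nonempty P by blast
  have "p \<in> V P" using P_subset_V P p by blast
  moreover have "H p \<le> H x" if "x \<in> V P" for x
    using V_H_ge(1)[OF P p that] V_subset[OF P] that by fastforce
  ultimately have "Min (H ` V P) = H p" by (intro Min_eqI) auto
  then show ?thesis using HP_eq P p by simp
qed

lemma depth_V: "P \<in> Ph \<Longrightarrow> depth E H (V P) = \<Gamma> P"
  by (simp add: depth_eq V_exit Min_V Gamma_eq)

lemma \<Gamma>star_le: "P \<in> Ph \<Longrightarrow> \<Gamma>star \<le> \<Gamma> P"
  by (simp add: GstarL_def)

lemma \<Gamma>star_attained: obtains P where "P \<in> Ph" "\<Gamma> P = \<Gamma>star"
proof -
  have "\<Gamma>star \<in> \<Gamma> ` Ph" unfolding GstarL_def using ex_other by (intro Min_in) auto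
  then show thesis using that by auto
qed

lemma g_less_\<Gamma>star: "g < \<Gamma>star"
proof -
  obtain P where P: "P \<in> Ph" "\<Gamma> P = \<Gamma>star" by (rule \<Gamma>star_attained)
  obtain p where p: "p \<in> P" using Ph_nonempty P by blast
  show ?thesis using ext_gt[OF P(1) p] HP_eq[OF P(1) p] P(2) Gamma_eq[of P] by simp
qed

text \<open>Two basins with a common point are nested. \<open>C\<close> cannot have the higher exit:
  it would contain \<open>P\<close>, and depth at most \<open>g\<close> would put its exit height
  below \<open>ext P\<close>.\<close>

lemma carry_subset_V:
  assumes "C \<in> carry" "P \<in> Ph" "x \<in> C" "x \<in> V P"
  shows "C \<subseteq> V P"
proof (cases "exit_height C \<le> ext P")
  case True
  then show ?thesis
    using basin_mem_iff[OF carry_basin[OF assms(1)] assms(3)]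
      basin_mem_iff[OF V_basin[OF assms(2)] assms(4)] V_exit[OF assms(2)] by auto
next
  case False
  then have sub: "V P \<subseteq> C"
    using basin_mem_iff[OF carry_basin[OF assms(1)] assms(3)]
      basin_mem_iff[OF V_basin[OF assms(2)] assms(4)] V_exit[OF assms(2)] by auto
  obtain p where p: "p \<in> P" using Ph_nonempty assms by blast
  then have "p \<in> C" using sub P_subset_V assms by blast
  then have "Min (H ` C) \<le> H p" by simp
  then have "exit_height C \<le> H p + g" using carry_depth[OF assms(1)] depth_eq[of C] by simp
  then show ?thesis using False ext_gt[OF assms(2) p] by simp
qed

section \<open>The family of cycles and its deep members\<close>

lemma V_in_Cs: "P \<in> Ph \<Longrightarrow> V P \<in> Cs"
  by (simp add: CsL_def)

lemma CsE:
  assumes "C \<in> Cs"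
  obtains P where "P \<in> Ph" "C = V P" | "C \<in> carry" "\<And>P. P \<in> Ph \<Longrightarrow> C \<inter> V P = {}"
proof (cases "C \<in> V ` Ph")
  case True
  then show thesis using that(1) by blast
next
  case False
  then have "C \<in> carry" "\<forall>P \<in> Ph. C \<inter> V P = {}" using assms by (auto simp: CsL_def)
  then show thesis using that(2) by blast
qed

lemma carry_covered: "\<Union>carry \<subseteq> \<Union>Cs"
proof
  fix x assume "x \<in> \<Union>carry"
  then obtain C where C: "C \<in> carry" "x \<in> C" by blast
  show "x \<in> \<Union>Cs"
  proof (cases "\<forall>P \<in> Ph. C \<inter> V P = {}")
    case True
    then have "C \<in> Cs" using C by (simp add: CsL_def)
    then show ?thesis using C by blast
  next
    case False
    then obtain P where "P \<in> Ph" "C \<inter> V P \<noteq> {}" by blast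
    then show ?thesis using C carry_subset_V V_in_Cs by blast
  qed
qed

lemma Cs_pairwise_disjoint:
  assumes "C \<in> Cs" "D \<in> Cs" "x \<in> C" "x \<in> D"
  shows "C = D"
  using assms(1)
proof (cases rule: CsE)
  case (1 P)
  from assms(2) show ?thesis
    by (cases rule: CsE) (use 1 assms V_disjoint in blast)+
next
  case 2
  from assms(2) show ?thesis
    by (cases rule: CsE) (use 2 assms carry_disjoint in blast)+
qed

sublocale cycle_chain E H "CsL E H Ph carry" "GstarL E H Ph"
proof
  fix C assume C: "C \<in> Cs"
  show basin: "basin C" using C by (rule CsE) (use carry_basin V_basin in blast)+
  show sub: "C \<subseteq> \<Omega>" using C by (rule CsE) (use carry_subset V_subset in blast)+
  \<comment> \<open>Distinct members of \<open>Ph\<close> have distinct \<open>V\<close>, so one of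
    these is not \<open>C\<close>. Going there from \<open>C\<close> means climbing to the exit
    height of \<open>C\<close>, while \<open>barPhi\<close> suffices inside
    \<open>\<Omega>\<close>.\<close>
  obtain P where P: "P \<in> Ph" "V P \<noteq> C"
  proof -
    obtain P where P: "P \<in> Ph" using ex_other by blast
    obtain Q where Q: "Q \<in> Ph" "Q \<noteq> P" using ex_other by blast
    obtain p where "p \<in> P" using Ph_nonempty P by blast
    then have "V P \<noteq> V Q" using V_disjoint[OF P Q(1)] P_subset_V[OF P] Q(2) by blast
    then show thesis using that P Q by metis
  qed
  obtain p where p: "p \<in> P" using Ph_nonempty P by blast
  have "p \<in> V P" using P_subset_V P p by blast
  then have "p \<notin> C" using Cs_pairwise_disjoint[OF V_in_Cs[OF P(1)] C] P(2) by blast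
  moreover obtain c where c: "c \<in> C" using basin_nonempty[OF basin] by blast
  ultimately have "exit_height C \<le> \<Phi> c p" using basin_mem_iff[OF basin c, of p] by simp
  also have "\<dots> \<le> barPhi E H"
    using c sub Ph_subset[OF P(1)] p by (intro barOmega_Phi_le) auto
  finally show "exit_height C \<le> barPhi E H" .
qed (rule Cs_pairwise_disjoint)

lemma Cstar_eq: "Cstar E H Cs \<Gamma>star = V ` Ph"
proof
  show "Cstar E H Cs \<Gamma>star \<subseteq> V ` Ph"
  proof
    fix C assume "C \<in> Cstar E H Cs \<Gamma>star"
    then have C: "C \<in> Cs" "\<Gamma>star \<le> depth E H C" by (auto simp: Cstar_def)
    from C(1) show "C \<in> V ` Ph"
    proof (cases rule: CsE)
      case 2
      then show ?thesis using C(2) carry_depth[of C] g_less_\<Gamma>star by simp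
    qed simp
  qed
  show "V ` Ph \<subseteq> Cstar E H Cs \<Gamma>star"
    using V_in_Cs depth_V \<Gamma>star_le by (auto simp: Cstar_def)
qed

section \<open>The bottoms F P and the jumps between them\<close>

lemma stars_eq: "stars = F ` Ph"
  by (auto simp: PCstar_def Cstar_eq)

lemma F_subset_\<Omega>: "P \<in> Ph \<Longrightarrow> F P \<subseteq> \<Omega>"
  using Fm_subset[of "V P"] V_subset[of P] by blast

lemma F_subset_V: "F P \<subseteq> V P"
  by (rule Fm_subset)

lemma F_H_eq: "P \<in> Ph \<Longrightarrow> x \<in> F P \<Longrightarrow> H x = HP H P"
  using Fm_eq_Min[of x "V P"] Min_V by simp

lemma P_subset_F: "P \<in> Ph \<Longrightarrow> P \<subseteq> F P"
proof
  fix p assume P: "P \<in> Ph" "p \<in> P"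
  then have "p \<in> V P" using P_subset_V by blast
  moreover have "H p \<le> H y" if "y \<in> V P" for y
    using that Min_V[OF P(1)] HP_eq[OF P] by (metis Min_le finite finite_imageI imageI)
  ultimately show "p \<in> F P" by (simp add: Fm_def)
qed

lemma F_inj: "P \<in> Ph \<Longrightarrow> Q \<in> Ph \<Longrightarrow> x \<in> F P \<Longrightarrow> x \<in> F Q \<Longrightarrow> P = Q"
  using V_disjoint[of P Q x] F_subset_V[of P] F_subset_V[of Q] by blast

lemma F_nonempty: "P \<in> Ph \<Longrightarrow> F P \<noteq> {}"
  using Fm_nonempty[OF basin_nonempty[OF V_basin]] by blast

lemma st_V: "P \<in> Ph \<Longrightarrow> x \<in> V P \<Longrightarrow> st x = F P"
  using st_in[OF V_in_Cs] by blast

lemma lev_V: "P \<in> Ph \<Longrightarrow> x \<in> V P \<Longrightarrow> lev x = HP H P + \<Gamma> P"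
  using lev_in[OF V_in_Cs] V_exit Gamma_eq by simp

lemma active_V: "P \<in> Ph \<Longrightarrow> x \<in> V P \<Longrightarrow> active x \<longleftrightarrow> \<Gamma> P = \<Gamma>star"
  using active_in[OF V_in_Cs, of P x] depth_V[of P] \<Gamma>star_le[of P] by auto

text \<open>\<open>F P\<close> can be left only if its depth is at most \<open>\<Gamma>star\<close>,
  the minimum of all \<open>\<Gamma>\<close>. The other bounds come from
  \<open>jump_rtrancl_le\<close>, as \<open>lev\<close> on \<open>V P\<close> is its exit
  height.\<close>

lemma F_jump:
  assumes "P \<in> Ph" "Q \<in> Ph" "P \<noteq> Q" "(F P, F Q) \<in> jump\<^sup>*" "p \<in> F P" "q \<in> F Q"
  shows "\<Gamma> P = \<Gamma>star" "HP H Q + \<Gamma> Q \<le> HP H P + \<Gamma>star" "\<Phi> p q \<le> H p + \<Gamma>star"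
proof -
  have pq: "p \<in> V P" "q \<in> V Q" "p \<in> \<Omega>" using assms F_subset_V V_subset by blast+
  then have st: "st p = F P" "st q = F Q" using st_V assms by auto
  have "F Q \<noteq> F P" using assms F_inj by blast
  then have "active p" using jump_rtrancl_active[of p "F Q"] pq st assms by simp
  then show \<Gamma>: "\<Gamma> P = \<Gamma>star" using active_V assms pq by blast
  have "lev q \<le> lev p" "\<Phi> p q \<le> lev p" using jump_rtrancl_le[of p q] pq st assms by auto
  then show "HP H Q + \<Gamma> Q \<le> HP H P + \<Gamma>star" "\<Phi> p q \<le> H p + \<Gamma>star"
    using lev_V[OF assms(1) pq(1)] lev_V[OF assms(2) pq(2)] \<Gamma> F_H_eq[OF assms(1,5)] by auto
qed

text \<open>A point of minimal level among those reached from \<open>x\<close> reaches everything below that level. So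
  it reaches some \<open>F P\<close> as soon as it reaches a carried cycle; otherwise it would lie on a stable
  plateau outside all cycles.\<close>
lemma reach_star:
  assumes "x \<in> \<Omega>"
  shows "\<exists>P \<in> Ph. (st x, F P) \<in> jump\<^sup>*"
proof (rule ccontr)
  assume none: "\<not> ?thesis"
  let ?S = "{y \<in> \<Omega>. (st x, st y) \<in> jump\<^sup>*}"
  have "finite ?S" "x \<in> ?S" using assms by auto
  then obtain y where "y \<in> ?S" and minS: "\<And>z. z \<in> ?S \<Longrightarrow> lev y \<le> lev z"
    by (rule finite_ex_min[where f = lev]) blast
  then have y: "y \<in> \<Omega>" "(st x, st y) \<in> jump\<^sup>*" by auto
  have min: "lev y \<le> lev z" if "z \<in> \<Omega>" "(st x, st z) \<in> jump\<^sup>*" for z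
    using minS that by blast
  have notV: "z \<notin> V P" if "(st y, st z) \<in> jump\<^sup>*" "P \<in> Ph" for z P
  proof
    assume "z \<in> V P"
    then have "st z = F P" using st_V that by blast
    then have "(st x, F P) \<in> jump\<^sup>*" using y(2) that(1) by (metis rtrancl_trans)
    then show False using none that by blast
  qed
  have flat: "lev z = lev y \<and> active z" if z: "z \<in> \<Omega>" "(st y, st z) \<in> jump\<^sup>*" for z
  proof
    show "lev z = lev y"
      using jump_rtrancl_le(1)[OF y(1) z(2)] min[OF z(1) rtrancl_trans[OF y(2) z(2)]] by simp
    show "active z"
    proof (cases "z \<in> \<Union>Cs")
      case True
      then obtain C where C: "C \<in> Cs" "z \<in> C" by blast
      from C(1) have "depth E H C \<le> \<Gamma>star"
      proof (cases rule: CsE)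
        case (1 P)
        then show ?thesis using notV z C by blast
      next
        case 2
        then show ?thesis using carry_depth[of C] g_less_\<Gamma>star by simp
      qed
      then show ?thesis using active_in C by simp
    qed (rule active_out)
  qed
  have reach: "z \<in> \<Omega> \<and> (st y, st z) \<in> jump\<^sup>*" if "\<Phi> y z \<le> lev y" for z
    using y(1) flat that by (rule Phi_le_lev_imp_jump)
  show False
  proof (cases "\<exists>z \<in> \<Omega>. (st y, st z) \<in> jump\<^sup>* \<and> z \<in> \<Union>Cs")
    case True
    then obtain z C where z: "z \<in> \<Omega>" "(st y, st z) \<in> jump\<^sup>*" and C: "C \<in> Cs" "z \<in> C" by blast
    from C(1) have "C \<in> carry" by (cases rule: CsE) (use notV z C in blast)+
    then obtain P p w where p: "P \<in> Ph" "p \<in> P" "w \<in> C" "\<Phi> w p \<le> exit_height C"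
      using carry_descend by blast
    \<comment> \<open>The way out given by \<open>carry_descend\<close> needs only the exit height
      of \<open>C\<close>, which is the minimal level, so the chain can follow it into some
      \<open>P\<close>.\<close>
    have e: "exit_height C = lev y" using lev_in[OF C] flat[OF z] by simp
    have "\<Phi> z w < lev y" using e C p(3) basin_mem_iff[OF Cs_basin] by metis
    then have "\<Phi> z p \<le> lev y" using p(4) e Phi_trans[of z w "lev y" p] by simp
    then have "\<Phi> y p \<le> lev y" using jump_rtrancl_le(2)[OF y(1) z(2)] Phi_trans by blast
    then have "(st y, st p) \<in> jump\<^sup>*" using reach by blast
    then show False using notV p P_subset_V by blast
  next
    case False
    then have out: "z \<notin> \<Union>Cs" if "\<Phi> y z \<le> lev y" for z using reach[OF that] by blast
    have "\<Phi> y y \<le> lev y" using H_le_lev[of y] by simp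
    then have Hy: "lev y = H y" using out lev_out by blast
    \<comment> \<open>Outside all cycles the level is the energy, so a constant level makes the
      energy constant on this component.\<close>
    have "H z = H y" if "\<Phi> y z \<le> H y" for z
      using that reach[of z] out[of z] flat[of z] lev_out[of z] Hy by simp
    then have "stable_plateau E H {z. \<Phi> y z \<le> H y}" by (rule stable_plateau_component)
    moreover have "{z. \<Phi> y z \<le> H y} \<subseteq> \<Omega>" using reach unfolding Hy by blast
    ultimately obtain z where "\<Phi> y z \<le> H y" "z \<in> \<Union>carry \<or> (\<exists>P \<in> Ph. z \<in> V P)"
      using plateau_covered by blast
    then show False using out[of z] Hy carry_covered V_in_Cs by auto
  qed
qed

section \<open>Separation of closed classes and the drop in their number\<close>

text \<open>Stated for every star outside \<open>K\<close>, transient ones included: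
  \<open>card_classes_less\<close> applies it to a star whose class is not known.\<close>

lemma class_Phi_gt:
  assumes K: "K \<in> classes" and P: "P \<in> Ph" "F P \<in> K" "p \<in> F P"
    and Q: "Q \<in> Ph" "F Q \<notin> K" "q \<in> F Q"
  shows "H p + \<Gamma>star < \<Phi> p q"
proof (rule ccontr)
  assume "\<not> ?thesis"
  then have le: "\<Phi> p q \<le> H p + \<Gamma>star" by simp
  have pq: "p \<in> V P" "q \<in> V Q" "p \<in> \<Omega>" using P Q F_subset_V V_subset by blast+
  then have st: "st p = F P" "st q = F Q" using st_V P Q by auto
  have "P \<noteq> Q" using P Q by blast
  then have "q \<notin> V P" using V_disjoint P Q pq by blast
  \<comment> \<open>Leaving \<open>V P\<close> costs at least its depth, so the assumed barrier
    forces this depth down to \<open>\<Gamma>star\<close>.\<close>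
  then have "HP H P + \<Gamma> P \<le> \<Phi> p q"
    using basin_mem_iff[OF V_basin[OF P(1)] pq(1), of q] V_exit[OF P(1)] Gamma_eq[of P] by simp
  then have \<Gamma>: "\<Gamma> P = \<Gamma>star"
    using le F_H_eq[OF P(1,3)] \<Gamma>star_le[OF P(1)] by simp
  have lp: "lev p = H p + \<Gamma>star" using lev_V[OF P(1) pq(1)] F_H_eq[OF P(1,3)] \<Gamma> by simp
  \<comment> \<open>\<open>reach_star\<close> leads every visited state to a star, which closedness
    puts into \<open>K\<close>; from there the chain returns to \<open>p\<close>, so the level
    cannot have dropped.\<close>
  have flat: "lev y = lev p \<and> active y" if y: "y \<in> \<Omega>" "(st p, st y) \<in> jump\<^sup>*" for y
  proof
    obtain R where R: "R \<in> Ph" "(st y, F R) \<in> jump\<^sup>*" using reach_star y by blast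
    then have "(F P, F R) \<in> jump\<^sup>*" using y(2) st by (metis rtrancl_trans)
    then have "F R \<in> K" using class_closed[OF K P(2)] R(1) stars_eq by blast
    then have "(F R, F P) \<in> jump\<^sup>*" using class_mutual[OF K] P(2) by blast
    then have "(st y, st p) \<in> jump\<^sup>*" using R(2) st by (metis rtrancl_trans)
    then show "lev y = lev p" using jump_rtrancl_le(1) y pq by (metis order.antisym)
    show "active y"
    proof (cases "st y = st p")
      case True
      then show ?thesis using same_state_le(3)[of y p] active_V[OF P(1) pq(1)] \<Gamma> by simp
    next
      case False
      then show ?thesis using jump_rtrancl_active[OF y(1) \<open>(st y, st p) \<in> jump\<^sup>*\<close>] by simp
    qed
  qed
  have "(st p, st q) \<in> jump\<^sup>*"
    using Phi_le_lev_imp_jump[OF pq(3) flat, of q] le lp by simp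
  then have "F Q \<in> K" using class_closed[OF K P(2)] st Q(1) stars_eq by simp
  then show False using Q(2) by simp
qed

lemma class_memE:
  assumes "K \<in> classes" "p \<in> \<Union>K"
  obtains P where "P \<in> Ph" "F P \<in> K" "p \<in> F P"
proof -
  obtain a where "a \<in> K" "p \<in> a" using assms(2) by blast
  moreover from this have "a \<in> F ` Ph" using class_subset[OF assms(1)] by (auto simp: stars_eq)
  ultimately show thesis using that by blast
qed

lemma class_starE:
  assumes "K \<in> classes"
  obtains P where "P \<in> Ph" "F P \<in> K"
proof -
  obtain a where "a \<in> K" using class_nonempty[OF assms] by blast
  moreover from this have "a \<in> F ` Ph" using class_subset[OF assms] by (auto simp: stars_eq)
  ultimately show thesis using that by blast
qed

lemma class_Union_nonempty: "K \<in> classes \<Longrightarrow> \<Union>K \<noteq> {}"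
  by (erule class_starE) (use F_nonempty in blast)

text \<open>For distinct members \<open>F_jump\<close> applies in both directions: both depths are
  \<open>\<Gamma>star\<close>, and the two inequalities between exit heights are opposite.\<close>

lemma class_heights_eq:
  assumes K: "K \<in> classes" and "P \<in> Ph" "F P \<in> K" "Q \<in> Ph" "F Q \<in> K"
  shows "HP H P = HP H Q" "ext P = ext Q"
proof -
  have "HP H P = HP H Q \<and> \<Gamma> P = \<Gamma> Q"
  proof (cases "P = Q")
    case False
    obtain p q where "p \<in> F P" "q \<in> F Q" using F_nonempty assms by blast
    then show ?thesis
      using F_jump[OF assms(2,4) False class_mutual[OF K assms(3,5)], of p q]
        F_jump[OF assms(4,2) _ class_mutual[OF K assms(5,3)], of q p] False by simp
  qed simp
  then show "HP H P = HP H Q" "ext P = ext Q" by (simp_all add: Gamma_eq)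
qed

lemma class_H_eq:
  assumes "K \<in> classes" "p \<in> \<Union>K" "q \<in> \<Union>K"
  shows "H q = H p"
proof -
  obtain P where P: "P \<in> Ph" "F P \<in> K" "p \<in> F P" using assms(1,2) by (rule class_memE)
  obtain Q where Q: "Q \<in> Ph" "F Q \<in> K" "q \<in> F Q" using assms(1,3) by (rule class_memE)
  show ?thesis
    using class_heights_eq(1)[OF assms(1) P(1,2) Q(1,2)] F_H_eq[OF P(1,3)] F_H_eq[OF Q(1,3)] by simp
qed

lemma F_Phi_le:
  assumes "P \<in> Ph" "x \<in> F P" "y \<in> F P"
  shows "\<Phi> x y \<le> H x + g"
proof -
  obtain p where p: "p \<in> P" using Ph_nonempty assms by blast
  have *: "\<Phi> p z \<le> H p + g" if "z \<in> F P" for z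
    using V_H_ge(2)[OF assms(1) p, of z] that F_subset_V[of P] F_subset_\<Omega>[OF assms(1)]
      F_H_eq[OF assms(1) that] HP_eq[OF assms(1) p] by auto
  have "H x = H p" using F_H_eq[OF assms(1,2)] HP_eq[OF assms(1) p] by simp
  then show ?thesis
    using *[OF assms(2)] *[OF assms(3)] Phi_sym[of x p] Phi_trans[of x p "H p + g" y] by simp
qed

lemma class_Phi_le:
  assumes "K \<in> classes" "p \<in> \<Union>K" "q \<in> \<Union>K"
  shows "\<Phi> p q \<le> H p + \<Gamma>star"
proof -
  obtain P where P: "P \<in> Ph" "F P \<in> K" "p \<in> F P" using assms(1,2) by (rule class_memE)
  obtain Q where Q: "Q \<in> Ph" "F Q \<in> K" "q \<in> F Q" using assms(1,3) by (rule class_memE)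
  show ?thesis
  proof (cases "P = Q")
    case True
    then show ?thesis using F_Phi_le[OF P(1,3)] Q(3) g_less_\<Gamma>star by fastforce
  next
    case False
    then show ?thesis
      using F_jump(3)[OF P(1) Q(1) _ class_mutual[OF assms(1) P(2) Q(2)] P(3) Q(3)] by blast
  qed
qed

text \<open>The bottoms are nonempty and disjoint, so a union of them determines its class. Hence
  the next level has as many members as there are closed classes.\<close>

lemma Union_inj_on_classes: "inj_on Union classes"
proof
  fix K L assume K: "K \<in> classes" and L: "L \<in> classes" and eq: "\<Union>K = \<Union>L"
  obtain P where P: "P \<in> Ph" "F P \<in> K" using K by (rule class_starE)
  then obtain p where p: "p \<in> F P" using F_nonempty by blast
  then have "p \<in> \<Union>L" using P eq by blast
  with L obtain Q where Q: "Q \<in> Ph" "F Q \<in> L" "p \<in> F Q" by (rule class_memE)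
  then have "Q = P" using F_inj P p by blast
  then show "K = L" using class_eqI[OF K L] P Q by blast
qed

lemma classes_nonempty: "classes \<noteq> {}"
proof -
  obtain P where "P \<in> Ph" using ex_other by blast
  then have "F P \<in> stars" using stars_eq by blast
  then obtain K b where "K \<in> classes" "b \<in> K" by (rule class_reached)
  then show ?thesis by blast
qed

text \<open>Choosing one star from each closed class is injective but not onto: with
  \<open>P\<close> of least depth and \<open>Q\<close> attaining its barrier,
  \<open>class_Phi_gt\<close> forces \<open>F Q\<close> into any closed class containing
  \<open>F P\<close>, so the two cannot both be representatives.\<close>

lemma card_classes_less: "card classes < card Ph"
proof -
  obtain P where P: "P \<in> Ph" "\<Gamma> P = \<Gamma>star" by (rule \<Gamma>star_attained)
  obtain p Q q where a: "p \<in> P" "Q \<in> Ph" "Q \<noteq> P" "q \<in> Q" "ext P = \<Phi> p q"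
    using P(1) by (rule ext_attained)
  have pq: "p \<in> F P" "q \<in> F Q" using a P P_subset_F by blast+
  have "\<Phi> p q = H p + \<Gamma>star" using a P Gamma_eq[of P] HP_eq[OF P(1) a(1)] by simp
  then have Q: "F Q \<in> K" if "K \<in> classes" "F P \<in> K" for K
    using class_Phi_gt[OF that(1) P(1) that(2) pq(1) a(2) _ pq(2)] by fastforce
  define r where "r = (\<lambda>K :: 'a set set. SOME a. a \<in> K)"
  have r: "r K \<in> K" if "K \<in> classes" for K
    unfolding r_def using class_nonempty[OF that] by (simp add: some_in_eq)
  have inj: "inj_on r classes" using class_eqI r by (intro inj_onI) metis
  have sub: "r ` classes \<subseteq> stars" using r class_subset by blast
  have "r ` classes \<noteq> stars"
  proof
    assume eq: "r ` classes = stars"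
    have "F P \<in> r ` classes" "F Q \<in> r ` classes" unfolding eq stars_eq using P a by blast+
    then obtain K L where K: "K \<in> classes" "F P = r K" and L: "L \<in> classes" "F Q = r L" by blast
    have "F Q \<in> K" using Q[OF K(1)] K r by simp
    then have "K = L" using class_eqI[OF K(1) L(1)] r[OF L(1)] L(2) by metis
    then have "F P = F Q" using K L by simp
    then show False using F_inj[OF P(1) a(2)] pq a(3) by blast
  qed
  then have "card (r ` classes) < card stars" using sub by (intro psubset_card_mono) auto
  also have "\<dots> \<le> card Ph" unfolding stars_eq by (intro card_image_le) simp
  finally show ?thesis using card_image[OF inj] by simp
qed

section \<open>Passage of the invariant to the next level\<close>

definition carry' :: "'a set set" where
  "carry' = {C \<in> Cstar E H Cs \<Gamma>star. Fm H C \<in> transientP E H Cs \<Gamma>star} \<union> Csharp E H Cs \<Gamma>star"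

lemma carry'E:
  assumes "C \<in> carry'"
  obtains P where "P \<in> Ph" "C = V P" "F P \<notin> \<Union>classes"
  | "C \<in> carry" "C \<in> Cs" "depth E H C < \<Gamma>star" "\<And>P. P \<in> Ph \<Longrightarrow> C \<inter> V P = {}"
proof (cases "C \<in> Csharp E H Cs \<Gamma>star")
  case True
  then have C: "C \<in> Cs" "depth E H C < \<Gamma>star" by (auto simp: Csharp_def)
  from C(1) show thesis
  proof (cases rule: CsE)
    case (1 P)
    then show thesis using C(2) depth_V \<Gamma>star_le[of P] by simp
  next
    case 2
    then show thesis using that(2) C by blast
  qed
next
  case False
  then have "C \<in> V ` Ph" "Fm H C \<in> transientP E H Cs \<Gamma>star"
    using assms by (auto simp: carry'_def Cstar_eq)
  then show thesis using that(1) by (auto simp: transientP_def)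
qed

lemma F_class_descend:
  assumes "P \<in> Ph"
  obtains K R r where "K \<in> classes" "R \<in> Ph" "F R \<in> K" "r \<in> F R" "(F P, F R) \<in> jump\<^sup>*"
proof -
  have "F P \<in> stars" using assms stars_eq by blast
  then obtain K b where K: "K \<in> classes" "b \<in> K" "(F P, b) \<in> jump\<^sup>*" by (rule class_reached)
  then have "b \<in> F ` Ph" using class_subset[OF K(1)] by (auto simp: stars_eq)
  then obtain R where R: "R \<in> Ph" "b = F R" by blast
  then obtain r where "r \<in> F R" using F_nonempty by blast
  then show thesis using that K R by blast
qed

text \<open>Every other class lies outside the \<open>V\<close> of each member of \<open>K\<close>,
  so the merged set exits no lower than the common \<open>ext\<close> of its members. This keeps
  stable plateaux covered at the next level.\<close>

lemma V_subset_next: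
  assumes two: "2 \<le> card classes" and K: "K \<in> classes" and P: "P \<in> Ph" "F P \<in> K" and x: "x \<in> V P"
  shows "x \<in> VL E H (Union ` classes) (\<Union>K)"
proof -
  let ?Ph = "Union ` classes"
  obtain p where p: "p \<in> F P" using F_nonempty P by blast
  obtain L where L: "L \<in> classes" "L \<noteq> K"
  proof -
    have "\<not> classes \<subseteq> {K}" using card_mono[of "{K}" classes] two by auto
    then show thesis using that by blast
  qed
  have "\<Union>L \<noteq> \<Union>K" using Union_inj_on_classes L K by (metis inj_onD)
  then have "\<Union>(?Ph - {\<Union>K}) \<noteq> {}" using L class_Union_nonempty[OF L(1)] by blast
  with class_Union_nonempty[OF K] obtain p' q where pq: "p' \<in> \<Union>K" "q \<in> \<Union>(?Ph - {\<Union>K})"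
    "PhiS E H (\<Union>K) (\<Union>(?Ph - {\<Union>K})) = \<Phi> p' q" by (rule PhiS_attained)
  obtain R where R: "R \<in> Ph" "F R \<in> K" "p' \<in> F R" using K pq(1) by (rule class_memE)
  obtain M where M: "M \<in> classes" "M \<noteq> K" "q \<in> \<Union>M" using pq(2) by blast
  obtain Q where Q: "Q \<in> Ph" "F Q \<in> M" "q \<in> F Q" using M(1,3) by (rule class_memE)
  have "Q \<noteq> R" using class_eqI[OF K M(1)] M(2) R(2) Q(2) by blast
  then have "q \<notin> V R" using V_disjoint[OF R(1) Q(1)] Q(3) F_subset_V[of Q] by blast
  moreover have "p' \<in> V R" using R F_subset_V by blast
  ultimately have "ext R \<le> \<Phi> p' q"
    using basin_mem_iff[OF V_basin[OF R(1)], of p' q] V_exit[OF R(1)] by simp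
  moreover have "ext P = ext R" using class_heights_eq(2)[OF K P R(1,2)] .
  moreover have "PhiS E H (\<Union>K) {x} \<le> \<Phi> p x" using p P by (intro PhiS_le) auto
  moreover have "p \<in> V P" using p F_subset_V by blast
  then have "\<Phi> p x < ext P"
    using basin_mem_iff[OF V_basin[OF P(1)], of p x] V_exit[OF P(1)] x by simp
  ultimately show ?thesis using pq(3) by (simp add: VL_def GamL_def)
qed

theorem next_level:
  assumes two: "2 \<le> card classes"
  shows "hierarchy_level E H (Union ` classes) carry' \<Gamma>star"
proof
  show "2 \<le> card (Union ` classes)" using two by (simp add: card_image[OF Union_inj_on_classes])
  show "0 \<le> \<Gamma>star" using g_nonneg g_less_\<Gamma>star by simp
next
  fix P assume "P \<in> Union ` classes"
  then obtain K where K: "K \<in> classes" "P = \<Union>K" by blast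
  then show "P \<noteq> {}" using class_Union_nonempty by blast
  show "P \<subseteq> \<Omega>"
  proof
    fix p assume "p \<in> P"
    then obtain Q where "Q \<in> Ph" "p \<in> F Q" using K class_memE[of K p] by blast
    then show "p \<in> \<Omega>" using F_subset_\<Omega> by blast
  qed
  fix p q assume p: "p \<in> P"
  show "H q = H p" if "q \<in> P" using class_H_eq[OF K(1), of p q] K(2) p that by simp
  show "\<Phi> p q \<le> H p + \<Gamma>star" if "q \<in> P" using class_Phi_le[OF K(1), of p q] K(2) p that by simp
  fix P' assume "P' \<in> Union ` classes" and ne: "P \<noteq> P'" and q: "q \<in> P'"
  then obtain L where L: "L \<in> classes" "P' = \<Union>L" by blast
  obtain A where A: "A \<in> Ph" "F A \<in> K" "p \<in> F A" using class_memE[OF K(1), of p] p K(2) by blast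
  obtain B where B: "B \<in> Ph" "F B \<in> L" "q \<in> F B" using class_memE[OF L(1), of q] q L(2) by blast
  have "F B \<notin> K" using class_eqI[OF K(1) L(1)] B(2) ne K(2) L(2) by blast
  then show "H p + \<Gamma>star < \<Phi> p q" using class_Phi_gt K(1) A B by blast
next
  fix x assume x: "x \<in> \<Omega>"
  obtain P p where p: "P \<in> Ph" "p \<in> P" "\<Phi> x p \<le> H x + g" "H p \<le> H x"
    using descend[OF x] by blast
  obtain K R r where K: "K \<in> classes" "R \<in> Ph" "F R \<in> K" "r \<in> F R" "(F P, F R) \<in> jump\<^sup>*"
    using p(1) by (rule F_class_descend)
  have pF: "p \<in> F P" using P_subset_F p by blast
  have xp: "\<Phi> x p \<le> H x + \<Gamma>star" using p(3) g_less_\<Gamma>star by simp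
  have "\<exists>q \<in> \<Union>K. \<Phi> x q \<le> H x + \<Gamma>star \<and> H q \<le> H x"
  proof (cases "P = R")
    case True
    then have "p \<in> \<Union>K" using K pF by blast
    then show ?thesis using xp p(4) by blast
  next
    case False
    note FJ = F_jump[OF p(1) K(2) False K(5) pF K(4)]
    have "\<Phi> p r \<le> H x + \<Gamma>star" using FJ(3) p(4) by simp
    then have "\<Phi> x r \<le> H x + \<Gamma>star" using xp Phi_trans by blast
    moreover have "H r \<le> H x"
      using FJ(2) \<Gamma>star_le[OF K(2)] F_H_eq[OF K(2,4)] HP_eq[OF p(1,2)] p(4) by simp
    ultimately show ?thesis using K by blast
  qed
  then show "\<exists>P \<in> Union ` classes. \<exists>p \<in> P. \<Phi> x p \<le> H x + \<Gamma>star \<and> H p \<le> H x"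
    using K(1) by blast
next
  fix C assume C: "C \<in> carry'"
  have CCs: "C \<in> Cs" using C by (rule carry'E) (use V_in_Cs in blast)+
  show "basin C" using Cs_basin CCs by blast
  show "C \<subseteq> \<Omega>" using Cs_subset CCs by blast
  show "C = D" if "D \<in> carry'" "x \<in> C" "x \<in> D" for D x
  proof -
    have "D \<in> Cs" using that(1) by (rule carry'E) (use V_in_Cs in blast)+
    then show ?thesis using Cs_disjoint CCs that by blast
  qed
  \<comment> \<open>If \<open>P\<close> leads to a different \<open>R\<close>, its depth is
    \<open>\<Gamma>star\<close>, so the passage to \<open>R\<close> climbs no higher than
    \<open>ext P\<close>.\<close>
  have descends: "\<exists>K \<in> classes. \<exists>r \<in> \<Union>K. \<Phi> x r \<le> e"
    if P: "P \<in> Ph" and p: "p \<in> F P" and xp: "\<Phi> x p \<le> e" and e: "ext P \<le> e" for P p x e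
  proof -
    obtain K R r where K: "K \<in> classes" "R \<in> Ph" "F R \<in> K" "r \<in> F R" "(F P, F R) \<in> jump\<^sup>*"
      using P by (rule F_class_descend)
    show ?thesis
    proof (cases "P = R")
      case True
      then show ?thesis using K p xp by blast
    next
      case False
      note FJ = F_jump[OF P K(2) False K(5) p K(4)]
      have "\<Phi> p r \<le> e" using FJ(1,3) F_H_eq[OF P p] Gamma_eq[of P] e by simp
      then show ?thesis using K xp Phi_trans by blast
    qed
  qed
  have "depth E H C \<le> \<Gamma>star \<and> (\<exists>K \<in> classes. \<exists>p \<in> \<Union>K. \<exists>x \<in> C. \<Phi> x p \<le> exit_height C)"
    using C
  proof (cases rule: carry'E)
    case (1 P)
    obtain K R r where K: "K \<in> classes" "R \<in> Ph" "F R \<in> K" "r \<in> F R" "(F P, F R) \<in> jump\<^sup>*"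
      using 1(1) by (rule F_class_descend)
    \<comment> \<open>A transient star leads to another star, which forces its depth to be exactly
      \<open>\<Gamma>star\<close>, the bound required of carried cycles.\<close>
    have "P \<noteq> R" using 1(3) K by blast
    obtain p where p: "p \<in> F P" using F_nonempty 1 by blast
    have "\<Gamma> P = \<Gamma>star" using F_jump(1)[OF 1(1) K(2) \<open>P \<noteq> R\<close> K(5) p K(4)] .
    then have "depth E H C \<le> \<Gamma>star" using 1 depth_V by simp
    have "p \<in> V P" using p F_subset_V by blast
    then have "\<Phi> p p \<le> ext P" using V_exit[OF 1(1)] basin_H_less[OF V_basin[OF 1(1)]] by fastforce
    then have "\<exists>K \<in> classes. \<exists>r \<in> \<Union>K. \<Phi> p r \<le> ext P" using descends 1(1) p by blast
    moreover have "exit_height C = ext P" "p \<in> C" using V_exit 1 \<open>p \<in> V P\<close> by auto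
    ultimately show ?thesis using \<open>depth E H C \<le> \<Gamma>star\<close> by auto
  next
    case 2
    obtain P p x where p: "P \<in> Ph" "p \<in> P" "x \<in> C" "\<Phi> x p \<le> exit_height C"
      using carry_descend[OF 2(1)] by blast
    \<comment> \<open>Since \<open>C\<close> misses \<open>V P\<close>, the old descent into
      \<open>P\<close> already climbs to \<open>ext P\<close>, and continuing from \<open>P\<close>
      to a closed class costs nothing more.\<close>
    have "x \<notin> V P" using 2(4) p by blast
    then have "ext P \<le> \<Phi> x p" using V_iff[OF p(1,2), of x] Phi_sym[of p x] by simp
    then have "ext P \<le> exit_height C" using p(4) by simp
    then have "\<exists>K \<in> classes. \<exists>r \<in> \<Union>K. \<Phi> x r \<le> exit_height C"
      using descends[OF p(1) _ p(4)] P_subset_F[OF p(1)] p(2) by blast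
    then show ?thesis using 2(3) p(3) by auto
  qed
  then show "depth E H C \<le> \<Gamma>star"
    "\<exists>P \<in> Union ` classes. \<exists>p \<in> P. \<exists>x \<in> C. \<Phi> x p \<le> exit_height C" by auto
next
  fix Q assume "stable_plateau E H Q" "Q \<subseteq> \<Omega>"
  then obtain x where xQ: "x \<in> Q" and "x \<in> \<Union>carry \<or> (\<exists>P \<in> Ph. x \<in> V P)"
    using plateau_covered by blast
  then have "x \<in> \<Union>Cs" using carry_covered V_in_Cs by blast
  then obtain C where C: "C \<in> Cs" "x \<in> C" by blast
  \<comment> \<open>A cycle that is not carried on is some \<open>V P\<close> with recurrent
    \<open>F P\<close>, and the new \<open>V\<close> contains it.\<close>
  have "x \<in> \<Union>carry' \<or> (\<exists>P \<in> Union ` classes. x \<in> VL E H (Union ` classes) P)"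
  proof (cases "C \<in> carry'")
    case True
    then show ?thesis using C by blast
  next
    case False
    then have star: "C \<in> Cstar E H Cs \<Gamma>star" "Fm H C \<notin> transientP E H Cs \<Gamma>star"
      using C(1) by (auto simp: carry'_def Csharp_def Cstar_def)
    then obtain P where P: "P \<in> Ph" "C = V P" using Cstar_eq by blast
    then have "F P \<in> stars" using stars_eq by blast
    then obtain K where "K \<in> classes" "F P \<in> K" using star P by (auto simp: transientP_def)
    then show ?thesis using V_subset_next[OF two _ P(1)] C P by blast
  qed
  then show "\<exists>x \<in> Q. x \<in> \<Union>carry' \<or> (\<exists>P \<in> Union ` classes. x \<in> VL E H (Union ` classes) P)"
    using xQ by blast
qed

end

section \<open>Iterating the levels\<close>

context landscape
begin

text \<open>A stable plateau communicates internally at its own energy and with the outside strictly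
  above it, which gives the clauses with \<open>g = 0\<close>.\<close>

lemma first_level:
  assumes "2 \<le> card (P1 E H)"
  shows "hierarchy_level E H (P1 E H) {} 0"
proof
  show "2 \<le> card (P1 E H)" by fact
  show "(0::real) \<le> 0" by simp
next
  fix P assume P: "P \<in> P1 E H"
  then have sp: "stable_plateau E H P" by (simp add: P1_def)
  then show "P \<noteq> {}" by (simp add: stable_plateau_def)
  show "P \<subseteq> \<Omega>" using P by (simp add: P1_def)
  fix p q assume p: "p \<in> P"
  show "H q = H p" if "q \<in> P" using stable_plateau_Phi_le[OF sp p that] by simp
  show "\<Phi> p q \<le> H p + 0" if "q \<in> P" using stable_plateau_Phi_le[OF sp p that] by simp
  fix Q assume "Q \<in> P1 E H" "P \<noteq> Q" "q \<in> Q"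
  then have "q \<notin> P" using stable_plateau_eqI[OF sp, of Q q] by (auto simp: P1_def)
  then show "H p + 0 < \<Phi> p q" using stable_plateau_Phi_gt[OF sp p] by simp
next
  fix x assume x: "x \<in> \<Omega>"
  obtain Q y where Q: "stable_plateau E H Q" "y \<in> Q" "\<Phi> x y \<le> H x"
    "\<And>z. z \<in> Q \<Longrightarrow> \<Phi> x z \<le> H x"
    by (rule stable_plateau_below[of x]) blast
  have "H x \<le> barPhi E H" using barOmega_Phi_le[OF x x] by simp
  then have "Q \<subseteq> \<Omega>" using Q(4) barOmega_closed[OF x] by fastforce
  then have "Q \<in> P1 E H" using Q by (simp add: P1_def)
  moreover have "H y \<le> H x" using Q(3) Phi_ge_right[of y x] by simp
  ultimately show "\<exists>P \<in> P1 E H. \<exists>p \<in> P. \<Phi> x p \<le> H x + 0 \<and> H p \<le> H x"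
    using Q(2,3) by auto
next
  fix Q assume Q: "stable_plateau E H Q" "Q \<subseteq> \<Omega>"
  then have QP: "Q \<in> P1 E H" by (simp add: P1_def)
  obtain p where p: "p \<in> Q" using Q(1) by (auto simp: stable_plateau_def)
  have "\<not> P1 E H \<subseteq> {Q}" using card_mono[of "{Q}" "P1 E H"] assms by auto
  then obtain R where R: "R \<in> P1 E H" "R \<noteq> Q" by blast
  then have "R \<noteq> {}" by (simp add: P1_def stable_plateau_def)
  then have "Q \<noteq> {}" "\<Union>(P1 E H - {Q}) \<noteq> {}" using R p by blast+
  then obtain a b where ab: "a \<in> Q" "b \<in> \<Union>(P1 E H - {Q})"
    "PhiS E H Q (\<Union>(P1 E H - {Q})) = \<Phi> a b" by (rule PhiS_attained)
  have "b \<notin> Q" using ab(2) stable_plateau_eqI[OF Q(1), of _ b] by (auto simp: P1_def)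
  then have "H a < \<Phi> a b" using stable_plateau_Phi_gt[OF Q(1) ab(1)] by simp
  moreover have "PhiS E H Q {a} \<le> H a" using PhiS_le[OF ab(1), of a "{a}"] by simp
  ultimately have "a \<in> VL E H (P1 E H) Q" using ab(3) by (simp add: VL_def GamL_def)
  then show "\<exists>x \<in> Q. x \<in> \<Union>{} \<or> (\<exists>P \<in> P1 E H. x \<in> VL E H (P1 E H) P)"
    using ab(1) QP by blast
qed auto

lemma lvl_Suc:
  "fst (lvl E H (Suc n)) = Union ` closed_classes E H
      (CsL E H (fst (lvl E H n)) (snd (lvl E H n))) (GstarL E H (fst (lvl E H n)))"
  "hierarchy_level E H (fst (lvl E H n)) (snd (lvl E H n)) g \<Longrightarrow>
    snd (lvl E H (Suc n)) = hierarchy_level.carry' E H (fst (lvl E H n)) (snd (lvl E H n))"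
  by (simp_all add: stepL_def Let_def hierarchy_level.carry'_def)

text \<open>\<open>nu\<close> counts closed classes while \<open>lvl\<close> stores their unions, so
  the equality of cardinalities rests on \<open>Union_inj_on_classes\<close>.\<close>

lemma hierarchy_level_lvl:
  assumes "\<And>k. k \<le> n \<Longrightarrow> 2 \<le> nu E H k"
  shows "(\<exists>g. hierarchy_level E H (fst (lvl E H n)) (snd (lvl E H n)) g)
    \<and> card (fst (lvl E H n)) = nu E H n"
  using assms
proof (induction n)
  case 0
  then show ?case using first_level by auto
next
  case (Suc n)
  then obtain g where "hierarchy_level E H (fst (lvl E H n)) (snd (lvl E H n)) g" by auto
  then interpret L: hierarchy_level E H "fst (lvl E H n)" "snd (lvl E H n)" g .
  have two: "2 \<le> card L.classes" using Suc.prems[of "Suc n"] by simp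
  have "fst (lvl E H (Suc n)) = Union ` L.classes" by (rule lvl_Suc(1))
  moreover have "snd (lvl E H (Suc n)) = L.carry'"
    using L.hierarchy_level_axioms by (rule lvl_Suc(2))
  ultimately show ?case
    using L.next_level[OF two] card_image[OF L.Union_inj_on_classes] by auto
qed

lemma nu_Suc_less:
  assumes "\<And>k. k \<le> n \<Longrightarrow> 2 \<le> nu E H k"
  shows "nu E H (Suc n) < nu E H n" "0 < nu E H (Suc n)"
proof -
  obtain g where "hierarchy_level E H (fst (lvl E H n)) (snd (lvl E H n)) g"
    using hierarchy_level_lvl[OF assms] by blast
  then interpret L: hierarchy_level E H "fst (lvl E H n)" "snd (lvl E H n)" g .
  show "nu E H (Suc n) < nu E H n"
    using L.card_classes_less hierarchy_level_lvl[OF assms] by simp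
  show "0 < nu E H (Suc n)" using L.classes_nonempty by (simp add: card_gt_0_iff)
qed

end

theorem mainTheorem6:
  fixes E :: "'a::finite \<Rightarrow> 'a \<Rightarrow> bool" and H :: "'a \<Rightarrow> real"
  assumes sym: "\<And>x y. E x y \<Longrightarrow> E y x"
    and irrefl: "\<And>x. \<not> E x x"
    and connected: "\<And>x y. \<exists>xs. walk E xs x y"
    and nu0: "nu E H 0 \<ge> 2"
  shows "(\<forall>h \<ge> 1. (\<forall>k < h. nu E H k \<ge> 2) \<longrightarrow> nu E H h < nu E H (h - 1))
       \<and> (\<exists>m \<ge> 1. (\<forall>k < m. nu E H k \<ge> 2) \<and> nu E H m = 1)"
proof -
  interpret landscape E H using sym connected by unfold_locales
  have step: "nu E H h < nu E H (h - 1)" "0 < nu E H h"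
    if "1 \<le> h" "\<forall>k < h. 2 \<le> nu E H k" for h
    using that nu_Suc_less[of "h - 1"] by auto
  have "\<exists>n. nu E H n < 2"
  proof (rule ccontr)
    assume "\<not> ?thesis"
    then have ge: "2 \<le> nu E H n" for n by (simp add: not_less)
    \<comment> \<open>Each level costs at least one class; taking \<open>n = nu E H 0\<close> leaves
      none.\<close>
    have "nu E H n + n \<le> nu E H 0" for n
    proof (induction n)
      case (Suc n)
      then show ?case using step(1)[of "Suc n"] ge by simp
    qed simp
    from this[of "nu E H 0"] ge[of "nu E H 0"] show False by simp
  qed
  define m where "m = (LEAST n. nu E H n < 2)"
  have m: "nu E H m < 2" unfolding m_def using \<open>\<exists>n. nu E H n < 2\<close> by (rule LeastI_ex)
  have below: "\<forall>k < m. 2 \<le> nu E H k"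
    unfolding m_def using not_less_Least by fastforce
  have "1 \<le> m" using m nu0 by (cases m) auto
  \<comment> \<open>The count at the first index below two is still positive, hence one.\<close>
  moreover have "nu E H m = 1" using step(2)[OF \<open>1 \<le> m\<close> below] m by simp
  ultimately show ?thesis using below step(1) by blast
qed

end
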